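(* Let $n\ge 1$. For integers $i,j$ and a sequence $D=(D(1),\dots,D(n))$ of pairs of integers, let $NC_n(i,j,D)$ denote the number of permutations $\sigma\in\mathfrak{S}_n$ with crossing number $\operatorname{Cr}(\sigma)=i$, nesting number $\operatorname{Ne}(\sigma)=j$, and degree sequence $D_\sigma=D$. Then for all $i,j,D$, \[NC_n(i,j,D)=NC_n(j,i,D).\]
   Context: For $\sigma\in\mathfrak{S}_n$, the arcs of $\sigma$ are the pairs $(a,\sigma(a))$, $1\le a\le n$. An arc is upper if $a\le\sigma(a)$ (this includes loops $a=\sigma(a)$) and lower if $a>\sigma(a)$. A $k$-crossing of $\sigma$ is a set of $k$ arcs $\{(a_i,\sigma(a_i)):1\le i\le k\}$ satisfying either $a_1<a_2<\dots<a_k\le\sigma(a_1)<\sigma(a_2)<\dots<\sigma(a_k)$ (upper $k$-crossing) or $\sigma(a_1)<\sigma(a_2)<\dots<\sigma(a_k)<a_1<a_2<\dots<a_k$ (lower $k$-crossing). A $k$-nesting is a set of $k$ arcs satisfying either $a_1<a_2<\dots<a_k\le\sigma(a_k)<\dots<\sigma(a_2)<\sigma(a_1)$ (upper $k$-nesting) or $\sigma(a_1)<\sigma(a_2)<\dots<\sigma(a_k)<a_k<\dots<a_2<a_1$ (lower $k$-nesting). (Equivalently, a $k$-crossing (resp. $k$-nesting) is a set of $k$ arcs every two of which cross (resp. nest), where two arcs $(a,\sigma(a)),(b,\sigma(b))$ cross if $a<b\le\sigma(a)<\sigma(b)$ or $\sigma(a)<\sigma(b)<a<b$, and nest if $a<b\le\sigma(b)<\sigma(a)$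 or $\sigma(a)<\sigma(b)<b<a$.) The crossing number $\operatorname{Cr}(\sigma)$ is the largest $k$ such that $\sigma$ has a $k$-crossing; the nesting number $\operatorname{Ne}(\sigma)$ is the largest $k$ such that $\sigma$ has a $k$-nesting. The degree sequence of $\sigma$ is $D_\sigma=(D_\sigma(v))_{v=1}^n$, where $D_\sigma(v)=(\text{indegree}(v),\text{outdegree}(v))$ in the directed graph on $\{1,\dots,n\}$ whose edges are the upper arcs $a\to\sigma(a)$ (with $a\le\sigma(a)$); i.e. $D_\sigma(v)=(\mathbf 1[\sigma^{-1}(v)\le v],\ \mathbf 1[v\le\sigma(v)])$. *)

theory Defs
  imports "HOL-Combinatorics.Permutations"
begin

text \<open>Permutations of {1..n} are functions nat => nat with sigma permutes {1..n}.
  An arc is identified by its starting point a (the arc is (a, sigma a)).\<close>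

definition crosses :: "(nat \<Rightarrow> nat) \<Rightarrow> nat \<Rightarrow> nat \<Rightarrow> bool" where
  "crosses \<sigma> a b \<longleftrightarrow>
     (a < b \<and> b \<le> \<sigma> a \<and> \<sigma> a < \<sigma> b) \<or> (\<sigma> a < \<sigma> b \<and> \<sigma> b < a \<and> a < b)"

definition nests :: "(nat \<Rightarrow> nat) \<Rightarrow> nat \<Rightarrow> nat \<Rightarrow> bool" where
  "nests \<sigma> a b \<longleftrightarrow>
     (a < b \<and> b \<le> \<sigma> b \<and> \<sigma> b < \<sigma> a) \<or> (\<sigma> a < \<sigma> b \<and> \<sigma> b < b \<and> b < a)"

definition is_k_crossing :: "nat \<Rightarrow> (nat \<Rightarrow> nat) \<Rightarrow> nat \<Rightarrow> bool" where
  "is_k_crossing n \<sigma> k \<longleftrightarrow> (\<exists>A. A \<subseteq> {1..n} \<and> card A = k \<and>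
     (\<forall>a\<in>A. \<forall>b\<in>A. a \<noteq> b \<longrightarrow> crosses \<sigma> a b \<or> crosses \<sigma> b a))"

definition is_k_nesting :: "nat \<Rightarrow> (nat \<Rightarrow> nat) \<Rightarrow> nat \<Rightarrow> bool" where
  "is_k_nesting n \<sigma> k \<longleftrightarrow> (\<exists>A. A \<subseteq> {1..n} \<and> card A = k \<and>
     (\<forall>a\<in>A. \<forall>b\<in>A. a \<noteq> b \<longrightarrow> nests \<sigma> a b \<or> nests \<sigma> b a))"

definition Cr :: "nat \<Rightarrow> (nat \<Rightarrow> nat) \<Rightarrow> nat" where
  "Cr n \<sigma> = Max {k. is_k_crossing n \<sigma> k}"

definition Ne :: "nat \<Rightarrow> (nat \<Rightarrow> nat) \<Rightarrow> nat" where
  "Ne n \<sigma> = Max {k. is_k_nesting n \<sigma> k}"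

definition degseq :: "nat \<Rightarrow> (nat \<Rightarrow> nat) \<Rightarrow> (int \<times> int) list" where
  "degseq n \<sigma> = map (\<lambda>v. (if inv \<sigma> v \<le> v then 1 else 0, if v \<le> \<sigma> v then 1 else 0)) [1..<n+1]"

definition NC :: "nat \<Rightarrow> int \<Rightarrow> int \<Rightarrow> (int \<times> int) list \<Rightarrow> nat" where
  "NC n i j D = card {\<sigma>. \<sigma> permutes {1..n} \<and> int (Cr n \<sigma>) = i \<and> int (Ne n \<sigma>) = j
                          \<and> degseq n \<sigma> = D}"

end

theory Submission
  imports Defs "HOL-Library.FuncSet"
begin

text \<open>
  Given the degree sequence, a permutation splits into two independent matchings of prescribed openers
  with prescribed closers: the upper arcs, and the lower arcs read from their smaller endpoint. In
  either one, a crossing (nesting) is a set of simultaneously open arcs that are closed in the same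
  (reverse) order in which they were opened. Scan such a matching from left to right and record the
  closers of the open arcs as a word; apply Schensted's row insertion to it. Opening an arc inserts a
  letter, closing one deletes the smallest letter, so the shape of the tableau gains or loses one corner
  in each step, and since insertion is invertible, every sequence of shapes with the prescribed pattern
  of gains and losses comes from exactly one matching. By Schensted's theorem the largest nesting and
  crossing are the largest number of columns and of rows among these shapes; transposing all shapes
  exchanges the two.
\<close>

text \<open>Two obstacles shape the argument. Both numbers are maxima over upper and lower arcs
  together, so exact values do not factor over the two families, but the bounds
  \<open>Cr \<le> i\<close> and \<open>Ne \<le> j\<close> do. Hence everything is counted for
  bounds, which on the tableau side say that all shapes stay inside an i by j box, and exact counts
  are recovered at the end. Moreover, transposition acts on shapes and is not visible on the
  matchings. So no involution on matchings is constructed: the number of ways to reach a given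
  tableau is shown to depend on its shape only, and to satisfy a recursion that is invariant under
  transposition. For this the claim at time t must cover tableaux of arbitrary content, since
  undoing an insertion at a corner releases a letter that depends on the entries.\<close>

section \<open>Chains in words\<close>

text \<open>Words list their latest letter first; \<open>R y x\<close> compares an earlier letter \<open>y\<close> with a later \<open>x\<close>.\<close>

fun chain_len :: "(nat \<Rightarrow> nat \<Rightarrow> bool) \<Rightarrow> nat list \<Rightarrow> nat" where
  "chain_len R [] = 0"
| "chain_len R (x # w) = max (chain_len R w) (Suc (chain_len R (filter (\<lambda>y. R y x) w)))"

lemma sorted_list_of_set_insert_max:
  fixes m :: nat
  assumes "finite B" "\<And>a. a \<in> B \<Longrightarrow> a < m"
  shows "sorted_list_of_set (insert m B) = sorted_list_of_set B @ [m]"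
proof -
  have "sorted (sorted_list_of_set B @ [m])" "distinct (sorted_list_of_set B @ [m])"
    using assms by (auto simp: sorted_append less_imp_le)
  moreover have "set (sorted_list_of_set B @ [m]) = insert m B"
    using assms by auto
  ultimately show ?thesis
    by (metis sorted_list_of_set.idem_if_sorted_distinct)
qed

lemma filter_sorted_list_of_set:
  fixes B :: "nat set"
  assumes "finite B"
  shows "filter P (sorted_list_of_set B) = sorted_list_of_set {a \<in> B. P a}"
proof -
  have "sorted (filter P (sorted_list_of_set B))" "distinct (filter P (sorted_list_of_set B))"
    by (auto intro: sorted_wrt_filter)
  moreover have "set (filter P (sorted_list_of_set B)) = {a \<in> B. P a}"
    using assms by auto
  ultimately show ?thesis
    by (metis sorted_list_of_set.idem_if_sorted_distinct)
qed

section \<open>Longest chains as sets of positions\<close>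

definition is_chain :: "(nat \<Rightarrow> nat \<Rightarrow> bool) \<Rightarrow> (nat \<Rightarrow> nat) \<Rightarrow> nat set \<Rightarrow> bool" where
  "is_chain R g A \<longleftrightarrow> (\<forall>a\<in>A. \<forall>b\<in>A. a < b \<longrightarrow> R (g a) (g b))"

abbreviation read :: "(nat \<Rightarrow> nat) \<Rightarrow> nat set \<Rightarrow> nat list" where
  "read g B \<equiv> map g (rev (sorted_list_of_set B))"

lemma read_remove_Max:
  assumes "finite B" "B \<noteq> {}"
  shows "read g B = g (Max B) # read g (B - {Max B})"
proof -
  have "a < Max B" if "a \<in> B - {Max B}" for a
    using that Max_ge[OF assms(1), of a] by (auto simp: less_le)
  moreover have "insert (Max B) (B - {Max B}) = B"
    using Max_in[OF assms] by auto
  ultimately show ?thesis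
    using sorted_list_of_set_insert_max[of "B - {Max B}" "Max B"] assms(1) by auto
qed

lemma filter_read:
  assumes "finite B"
  shows "filter P (read g B) = read g {a \<in> B. P (g a)}"
  by (simp add: filter_map o_def rev_filter[symmetric] filter_sorted_list_of_set[OF assms])

text \<open>Turns the recursion over words into one over sets of positions: a longest chain either
  avoids the last position or consists of it and a chain among the earlier positions related to
  it.\<close>

lemma chain_len_read_Max:
  assumes "finite B" "B \<noteq> {}"
  shows "chain_len R (read g B) = max (chain_len R (read g (B - {Max B})))
    (Suc (chain_len R (read g {a \<in> B - {Max B}. R (g a) (g (Max B))})))"
  by (simp only: read_remove_Max[OF assms] chain_len.simps filter_read[OF finite_Diff[OF assms(1)]])

lemma chain_len_attained:
  assumes "transp R" "finite B"
  shows "\<exists>A\<subseteq>B. is_chain R g A \<and> card A = chain_len R (read g B)"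
  using assms(2)
proof (induction B rule: finite_psubset_induct)
  case (psubset B)
  show ?case
  proof (cases "B = {}")
    case True
    then show ?thesis by (auto simp: is_chain_def)
  next
    case False
    define m where "m = Max B"
    define B' where "B' = B - {m}"
    have mB: "m \<in> B" and fin: "finite B'" "finite B"
      using False psubset by (auto simp: m_def B'_def)
    define C where "C = {a \<in> B'. R (g a) (g m)}"
    have sub: "B' \<subset> B" "C \<subset> B"
      using mB by (auto simp: B'_def C_def)
    have lt: "a < m" if "a \<in> B'" for a
      using that Max_ge[OF psubset(1), of a] by (auto simp: B'_def m_def less_le)
    have len: "chain_len R (read g B) = max (chain_len R (read g B')) (Suc (chain_len R (read g C)))"
      unfolding C_def B'_def m_def using chain_len_read_Max[OF psubset(1) False] .
    obtain A1 where A1: "A1 \<subseteq> B'" "is_chain R g A1" "card A1 = chain_len R (read g B')"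
      using psubset.IH[OF sub(1)] by auto
    obtain A2 where A2: "A2 \<subseteq> C" "is_chain R g A2" "card A2 = chain_len R (read g C)"
      using psubset.IH[OF sub(2)] by auto
    have m2: "m \<notin> A2" "finite A2"
      using A2(1) fin(1) by (auto simp: C_def B'_def intro: finite_subset)
    have "is_chain R g (insert m A2)"
      unfolding is_chain_def
    proof (intro ballI impI)
      fix a b assume ab: "a \<in> insert m A2" "b \<in> insert m A2" "a < b"
      have "\<And>a. a \<in> A2 \<Longrightarrow> a < m \<and> R (g a) (g m)"
        using A2(1) lt by (auto simp: C_def)
      then show "R (g a) (g b)"
        using ab A2(2) by (auto simp: is_chain_def dest: less_asym)
    qed
    moreover have "card (insert m A2) = Suc (chain_len R (read g C))"
      using m2 A2(3) by simp
    moreover have "insert m A2 \<subseteq> B"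
      using A2(1) sub mB by auto
    ultimately show ?thesis
      using A1 sub len by (metis max_def order_trans psubset_imp_subset)
  qed
qed

lemma chain_len_upper:
  assumes "finite B" "A \<subseteq> B" "is_chain R g A"
  shows "card A \<le> chain_len R (read g B)"
  using assms
proof (induction B arbitrary: A rule: finite_psubset_induct)
  case (psubset B)
  show ?case
  proof (cases "B = {}")
    case True
    then show ?thesis using psubset by auto
  next
    case False
    define m where "m = Max B"
    define B' where "B' = B - {m}"
    have mB: "m \<in> B" and fin: "finite B'" "finite B"
      using False psubset by (auto simp: m_def B'_def)
    define C where "C = {a \<in> B'. R (g a) (g m)}"
    have sub: "B' \<subset> B" "C \<subset> B"
      using mB by (auto simp: B'_def C_def)
    have lt: "a < m" if "a \<in> B'" for a
      using that Max_ge[OF psubset(1), of a] by (auto simp: B'_def m_def less_le)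
    have len: "chain_len R (read g B) = max (chain_len R (read g B')) (Suc (chain_len R (read g C)))"
      unfolding C_def B'_def m_def using chain_len_read_Max[OF psubset(1) False] .
    show ?thesis
    proof (cases "m \<in> A")
      case True
      have "A - {m} \<subseteq> C"
        using psubset.prems True lt by (auto simp: C_def B'_def is_chain_def)
      moreover have "is_chain R g (A - {m})"
        using psubset.prems by (auto simp: is_chain_def)
      ultimately have "card (A - {m}) \<le> chain_len R (read g C)"
        using psubset.IH[OF sub(2)] by blast
      moreover have "finite A"
        using psubset finite_subset by blast
      ultimately show ?thesis
        using True len by (simp add: card_Diff_singleton)
    next
      case False
      then have "A \<subseteq> B'" using psubset.prems by (auto simp: B'_def)
      then have "card A \<le> chain_len R (read g B')"
        using psubset.IH[OF sub(1)] psubset.prems by blast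
      then show ?thesis using len by simp
    qed
  qed
qed

lemma chain_len_le_iff:
  assumes "transp R" "finite B"
  shows "chain_len R (read g B) \<le> k \<longleftrightarrow> (\<forall>A\<subseteq>B. is_chain R g A \<longrightarrow> card A \<le> k)"
  using chain_len_attained[OF assms, of g] chain_len_upper[OF assms(2)] order_trans by metis

section \<open>Row insertion and Schensted's theorem\<close>

text \<open>Insertion is taken with respect to the reversed order of letters: a letter bumps the largest
  smaller one. Then deleting the smallest letter of a word just erases it from the tableau.\<close>

definition bump :: "nat \<Rightarrow> nat set \<Rightarrow> nat option" where
  "bump x r = (if \<exists>y\<in>r. y < x then Some (Max {y \<in> r. y < x}) else None)"

definition row_insert :: "nat \<Rightarrow> nat set \<Rightarrow> nat set" where
  "row_insert x r = insert x (r - set_option (bump x r))"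

primrec first_row :: "nat list \<Rightarrow> nat set" where
  "first_row [] = {}"
| "first_row (x # w) = row_insert x (first_row w)"

primrec bumped :: "nat list \<Rightarrow> nat list" where
  "bumped [] = []"
| "bumped (x # w) = (case bump x (first_row w) of None \<Rightarrow> bumped w | Some b \<Rightarrow> b # bumped w)"

definition P_tab :: "nat list \<Rightarrow> nat \<Rightarrow> nat set" where
  "P_tab w r = first_row ((bumped ^^ r) w)"

lemma bump_Some_iff:
  assumes "finite r"
  shows "bump x r = Some b \<longleftrightarrow> b \<in> r \<and> b < x \<and> (\<forall>y\<in>r. y < x \<longrightarrow> y \<le> b)"
proof -
  have "Max {y \<in> r. y < x} = b \<longleftrightarrow> b \<in> {y \<in> r. y < x} \<and> (\<forall>y\<in>{y \<in> r. y < x}. y \<le> b)"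
    if "\<exists>y\<in>r. y < x"
    using that assms by (intro Max_eq_iff) auto
  then show ?thesis by (auto simp: bump_def)
qed

lemma bump_None_iff: "bump x r = None \<longleftrightarrow> (\<forall>y\<in>r. \<not> y < x)"
  by (auto simp: bump_def)

lemma finite_row_insert: "finite r \<Longrightarrow> finite (row_insert x r)"
  by (simp add: row_insert_def)

lemma finite_first_row: "finite (first_row w)"
  by (induction w) (auto simp: finite_row_insert)

lemma set_eq_first_row_bumped: "set w = first_row w \<union> set (bumped w)"
proof (induction w)
  case (Cons x w)
  then show ?case
    using bump_Some_iff[OF finite_first_row, of x w]
    by (cases "bump x (first_row w)") (auto simp: row_insert_def)
qed auto

lemma distinct_bumped:
  assumes "distinct w"
  shows "first_row w \<inter> set (bumped w) = {} \<and> distinct (bumped w)"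
  using assms
proof (induction w)
  case (Cons x w)
  then show ?case
    using bump_Some_iff[OF finite_first_row, of x w] set_eq_first_row_bumped[of w]
    by (cases "bump x (first_row w)") (auto simp: row_insert_def)
qed auto

lemma length_bumped: "length (bumped w) \<le> length w - 1"
proof (induction w)
  case (Cons x w)
  then show ?case
    by (cases w; cases "bump x (first_row w)") (auto simp: bump_def)
qed auto

lemma first_row_empty_iff: "first_row w = {} \<longleftrightarrow> w = []"
  by (cases w) (auto simp: row_insert_def)

text \<open>Letters up to \<open>y\<close> never influence the larger ones: an inserted letter that
  is at most \<open>y\<close> bumps only smaller letters, and a larger letter that bumps something
  at most \<open>y\<close> bumps nothing once the small letters are gone. So erasing small letters
  commutes with insertion.\<close>

lemma first_row_bumped_filter:
  "first_row (filter (\<lambda>v. y < v) w) = first_row w \<inter> {y<..} \<and>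
   bumped (filter (\<lambda>v. y < v) w) = filter (\<lambda>v. y < v) (bumped w)"
proof (induction w)
  case (Cons x w)
  let ?r = "first_row w"
  have fin: "finite ?r" "finite (?r \<inter> {y<..})" using finite_first_row by auto
  show ?case
  proof (cases "y < x")
    case False
    have "\<not> y < b" if "bump x ?r = Some b" for b
      using that False bump_Some_iff[OF fin(1)] by auto
    then show ?thesis using Cons False
      by (cases "bump x ?r") (auto simp: row_insert_def)
  next
    case True
    show ?thesis
    proof (cases "bump x ?r")
      case None
      then have "bump x (?r \<inter> {y<..}) = None" by (auto simp: bump_None_iff)
      then show ?thesis using Cons True None by (auto simp: row_insert_def)
    next
      case (Some b)
      then have b: "b \<in> ?r" "b < x" "\<forall>z\<in>?r. z < x \<longrightarrow> z \<le> b"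
        using bump_Some_iff[OF fin(1)] by auto
      show ?thesis
      proof (cases "y < b")
        case True
        then have "bump x (?r \<inter> {y<..}) = Some b"
          using b bump_Some_iff[OF fin(2)] by auto
        then show ?thesis using Cons \<open>y < x\<close> True Some by (auto simp: row_insert_def)
      next
        case False
        then have "bump x (?r \<inter> {y<..}) = None"
          using b by (fastforce simp: bump_None_iff)
        then show ?thesis using Cons \<open>y < x\<close> False Some by (auto simp: row_insert_def)
      qed
    qed
  qed
qed auto

lemma P_tab_filter: "P_tab (filter (\<lambda>v. y < v) w) r = P_tab w r \<inter> {y<..}"
proof -
  have "(bumped ^^ r) (filter (\<lambda>v. y < v) w) = filter (\<lambda>v. y < v) ((bumped ^^ r) w)"
    by (induction r) (auto simp: first_row_bumped_filter)
  then show ?thesis by (simp add: P_tab_def first_row_bumped_filter)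
qed

text \<open>The induction is on the length because the hypothesis is also needed for the letters
  above the new one, whose first row is the part of the row above it. If nothing is bumped, that
  part is the whole row and the maximum grows by one; otherwise it is a proper part and the old
  maximum stands.\<close>

lemma card_first_row:
  assumes "distinct w"
  shows "card (first_row w) = chain_len (>) w"
  using assms
proof (induction "length w" arbitrary: w rule: less_induct)
  case less
  show ?case
  proof (cases w)
    case (Cons x v)
    let ?r = "first_row v"
    have fin: "finite ?r" by (rule finite_first_row)
    have x: "x \<notin> ?r" using less.prems Cons set_eq_first_row_bumped[of v] by auto
    have 1: "card ?r = chain_len (>) v" using less Cons by auto
    have "card (first_row (filter (\<lambda>y. y > x) v)) = chain_len (>) (filter (\<lambda>y. y > x) v)"
      using less Cons by (intro less.hyps) (auto simp: less_Suc_eq_le)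
    then have 2: "card (?r \<inter> {x<..}) = chain_len (>) (filter (\<lambda>y. y > x) v)"
      by (simp add: first_row_bumped_filter)
    show ?thesis
    proof (cases "bump x ?r")
      case None
      then have "?r \<inter> {x<..} = ?r" using x
        by (auto simp: bump_None_iff) (metis linorder_neqE_nat)
      then show ?thesis using 1 2 Cons None x fin by (simp add: row_insert_def)
    next
      case (Some b)
      then have b: "b \<in> ?r" "b < x" using bump_Some_iff[OF fin] by auto
      then have "b \<in> ?r - {x<..}" by auto
      then have "?r \<inter> {x<..} \<subset> ?r" by blast
      then have "card (?r \<inter> {x<..}) < card ?r" using fin by (rule psubset_card_mono[rotated])
      moreover have "card (insert x (?r - {b})) = card ?r"
        using b x fin card_Suc_Diff1[OF fin b(1)] by simp
      ultimately show ?thesis using 1 2 Cons Some by (simp add: row_insert_def)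
    qed
  qed auto
qed

section \<open>Increasing chains and the number of rows\<close>

lemma chain_len_filter_less_Cons:
  "chain_len (<) (filter (\<lambda>v. v < z) (x # w)) =
    (if x < z then max (chain_len (<) (filter (\<lambda>v. v < z) w)) (Suc (chain_len (<) (filter (\<lambda>v. v < x) w)))
     else chain_len (<) (filter (\<lambda>v. v < z) w))"
proof -
  have "filter (\<lambda>v. v < x) (filter (\<lambda>v. v < z) w) = filter (\<lambda>v. v < x) w" if "x < z"
    using that by (auto simp: filter_filter intro: filter_cong)
  then show ?thesis by auto
qed

lemma chain_len_filter_less_mono:
  "s \<le> z \<Longrightarrow> chain_len (<) (filter (\<lambda>v. v < s) w) \<le> chain_len (<) (filter (\<lambda>v. v < z) w)"
proof (induction w)
  case (Cons x w)
  then show ?case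
    by (simp only: chain_len_filter_less_Cons) (auto simp: le_max_iff_disj)
qed auto

text \<open>The letter bumped by \<open>z\<close> before and after inserting \<open>x\<close>, in
  the positions of \<open>z\<close> that the next induction distinguishes: at most \<open>x\<close>
  in the first four facts, above it in the last three.\<close>

lemma bump_row_insert:
  assumes "finite r" "x \<notin> r"
  shows "z \<le> x \<Longrightarrow> bump x r = None \<Longrightarrow> bump z (row_insert x r) = None"
    and "bump x r = Some b \<Longrightarrow> z \<le> b \<Longrightarrow> bump z (row_insert x r) = bump z r"
    and "bump x r = Some b \<Longrightarrow> b < z \<Longrightarrow> z \<le> x \<Longrightarrow> bump z r = Some b"
    and "bump x r = Some b \<Longrightarrow> b < z \<Longrightarrow> z \<le> x \<Longrightarrow> bump z (row_insert x r) = Some s \<Longrightarrow> s < b"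
    and "x < z \<Longrightarrow> bump z r = Some s \<Longrightarrow> x < s \<Longrightarrow> bump z (row_insert x r) = Some s"
    and "x < z \<Longrightarrow> bump z r = Some s \<Longrightarrow> s < x \<Longrightarrow> bump x r = Some s \<and> bump z (row_insert x r) = Some x"
    and "x < z \<Longrightarrow> bump z r = None \<Longrightarrow> bump x r = None \<and> bump z (row_insert x r) = Some x"
proof -
  note bs = bump_Some_iff[OF assms(1)] bump_Some_iff[OF finite_row_insert[OF assms(1)]] bump_None_iff
  show "z \<le> x \<Longrightarrow> bump x r = None \<Longrightarrow> bump z (row_insert x r) = None"
    by (auto simp: bs row_insert_def)
  show "bump x r = Some b \<Longrightarrow> b < z \<Longrightarrow> z \<le> x \<Longrightarrow> bump z r = Some b"
    by (auto simp: bs)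
  show "bump z (row_insert x r) = Some s" if "x < z" "bump z r = Some s" "x < s"
    using that bs(1)[of x s] unfolding bs(1)[of z] bs(2) by (auto simp: row_insert_def)
  show "bump x r = Some s \<and> bump z (row_insert x r) = Some x" if "x < z" "bump z r = Some s" "s < x"
  proof -
    have b: "bump x r = Some s" using that by (auto simp: bs)
    show ?thesis using that assms(2) unfolding bs(2) by (auto simp: row_insert_def b) (auto simp: bs)
  qed
  show "bump x r = None \<and> bump z (row_insert x r) = Some x" if "x < z" "bump z r = None"
  proof -
    have b: "bump x r = None" using that by (auto simp: bs)
    show ?thesis using that unfolding bs(2) by (auto simp: row_insert_def b) (auto simp: bs)
  qed
  show "bump z (row_insert x r) = bump z r" if b: "bump x r = Some b" and "z \<le> b"
  proof -
    have "{y \<in> row_insert x r. y < z} = {y \<in> r. y < z}"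
      using that bs(1)[of x b] by (auto simp: row_insert_def)
    then show ?thesis unfolding bump_def by (metis (mono_tags, lifting) mem_Collect_eq)
  qed
  show "s < b" if b: "bump x r = Some b" and "b < z" "z \<le> x" "bump z (row_insert x r) = Some s"
    using that(2-) bs(1)[of x b] b unfolding bs(2) by (auto simp: row_insert_def b less_le)
qed

text \<open>The letter \<open>bump z (first_row w)\<close> is the one that a further insertion of \<open>z\<close> would push into the
  bumped word; this makes the statement stable under extending \<open>w\<close>.\<close>

lemma chain_len_filter_less_bumped:
  assumes "distinct w"
  shows "chain_len (<) (filter (\<lambda>v. v < z) w) =
    (case bump z (first_row w) of
       None \<Rightarrow> chain_len (<) (filter (\<lambda>v. v < z) (bumped w))
     | Some s \<Rightarrow> max (chain_len (<) (filter (\<lambda>v. v < z) (bumped w)))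
                     (Suc (chain_len (<) (filter (\<lambda>v. v < s) (bumped w)))))"
  using assms
proof (induction w arbitrary: z)
  case (Cons x w)
  define E where "E z = chain_len (<) (filter (\<lambda>v. v < z) (bumped w))" for z
  let ?r = "first_row w"
  have mono: "\<And>s z. s \<le> z \<Longrightarrow> E s \<le> E z"
    unfolding E_def by (rule chain_len_filter_less_mono)
  have x: "x \<notin> ?r" using Cons.prems set_eq_first_row_bumped[of w] by auto
  note bri = bump_row_insert[OF finite_first_row x]
  note bS = bump_Some_iff[OF finite_first_row, of _ w]
  have IH: "chain_len (<) (filter (\<lambda>v. v < z) w) =
      (case bump z ?r of None \<Rightarrow> E z | Some s \<Rightarrow> max (E z) (Suc (E s)))" for z
    using Cons unfolding E_def by simp
  have E': "chain_len (<) (filter (\<lambda>v. v < z) (bumped (x # w))) =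
      (case bump x ?r of None \<Rightarrow> E z | Some b \<Rightarrow> if b < z then max (E z) (Suc (E b)) else E z)" for z
    by (cases "bump x ?r") (simp_all only: E_def bumped.simps option.case chain_len_filter_less_Cons)
  \<comment> \<open>With the recursions substituted, an identity remains in which \<open>E\<close>
    enters only through its monotonicity: the two sides differ in which letters are bumped, and
    terms with smaller arguments are absorbed by the maxima.\<close>
  have "(if x < z then max (case bump z ?r of None \<Rightarrow> E z | Some s \<Rightarrow> max (E z) (Suc (E s)))
        (Suc (case bump x ?r of None \<Rightarrow> E x | Some s \<Rightarrow> max (E x) (Suc (E s))))
      else (case bump z ?r of None \<Rightarrow> E z | Some s \<Rightarrow> max (E z) (Suc (E s)))) =
      (case bump z (row_insert x ?r) of
        None \<Rightarrow> (case bump x ?r of None \<Rightarrow> E z | Some b \<Rightarrow> if b < z then max (E z) (Suc (E b)) else E z)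
      | Some s \<Rightarrow> max (case bump x ?r of None \<Rightarrow> E z | Some b \<Rightarrow> if b < z then max (E z) (Suc (E b)) else E z)
         (Suc (case bump x ?r of None \<Rightarrow> E s | Some b \<Rightarrow> if b < s then max (E s) (Suc (E b)) else E s)))"
  proof (cases "x < z")
    case False
    then have zx: "z \<le> x" by simp
    show ?thesis
    proof (cases "bump x ?r")
      case None
      then have "bump z ?r = None" using zx by (auto simp: bump_None_iff)
      then show ?thesis using None False bri(1)[OF zx None] by simp
    next
      case (Some b)
      show ?thesis
      proof (cases "z \<le> b")
        case True
        have "s < z" if "bump z ?r = Some s" for s using that bS by auto
        then show ?thesis using Some False True bri(2)[OF Some True]
          by (auto split: option.splits)
      next
        case zb: False
        then have bz: "b < z" by simp
        \<comment> \<open>The term \<open>Suc (E s)\<close> is absorbed by the term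
          \<open>Suc (E b)\<close> that the bumped letter \<open>b\<close> contributes on both
          sides.\<close>
        have "s < b \<and> E s \<le> E b" if "bump z (row_insert x ?r) = Some s" for s
          using bri(4)[OF Some bz zx that] mono by simp
        then show ?thesis using Some False bz bri(3)[OF Some bz zx]
          by (auto split: option.splits)
      qed
    qed
  next
    case True
    show ?thesis
    proof (cases "bump z ?r")
      case None
      then show ?thesis using True bri(7)[OF True None] by simp
    next
      case (Some s)
      then have "s \<noteq> x" using x bS by auto
      then consider "x < s" | "s < x" by linarith
      then show ?thesis
      proof cases
        case 1
        have "b < x" if "bump x ?r = Some b" for b using that bS by auto
        then show ?thesis using True Some 1 bri(5)[OF True Some 1] mono[of x s]
          by (auto split: option.splits)
      next
        case 2
        then show ?thesis using True Some bri(6)[OF True Some 2] by auto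
      qed
    qed
  qed
  then show ?case
    by (simp only: E' chain_len_filter_less_Cons[of z x w] IH first_row.simps)
qed (simp add: bump_def)

text \<open>A bumped letter is replaced in its row by a larger one, so the maximum of the row never
  drops below a letter already inserted.\<close>

lemma le_first_row:
  "v \<in> set w \<Longrightarrow> \<exists>y\<in>first_row w. v \<le> y"
proof (induction w)
  case (Cons x w)
  show ?case
  proof (cases "v = x")
    case False
    then obtain y where y: "y \<in> first_row w" "v \<le> y" using Cons by auto
    show ?thesis
    proof (cases "bump x (first_row w) = Some y")
      case True
      then show ?thesis using y bump_Some_iff[OF finite_first_row, of x w y] by (auto simp: row_insert_def)
    next
      case False
      then show ?thesis using y by (auto simp: row_insert_def intro!: bexI[of _ y])
    qed
  qed (auto simp: row_insert_def)
qed auto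

text \<open>A threshold \<open>z\<close> above all letters makes the next bumped letter the maximum
  of the first row, which exceeds the whole bumped word. Both filters become vacuous, and each row
  accounts for exactly one step of the longest increasing chain.\<close>

lemma chain_len_bumped:
  assumes "distinct w" "w \<noteq> []"
  shows "chain_len (<) w = Suc (chain_len (<) (bumped w))"
proof -
  define z where "z = Suc (Max (set w))"
  let ?m = "Max (first_row w)"
  have lt: "v < z" if "v \<in> set w" for v using that by (simp add: z_def less_Suc_eq_le)
  have ne: "first_row w \<noteq> {}" using assms first_row_empty_iff by auto
  note Un = set_eq_first_row_bumped[of w]
  have m: "?m \<in> first_row w" using ne finite_first_row by simp
  have bz: "bump z (first_row w) = Some ?m"
    unfolding bump_Some_iff[OF finite_first_row]
    using m lt Max_ge[OF finite_first_row, of _ w] by (simp add: Un)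
  have "v < ?m" if "v \<in> set (bumped w)" for v
  proof -
    have "v \<in> set w" using that Un by simp
    then obtain y where "y \<in> first_row w" "v \<le> y" using le_first_row by blast
    then have "v \<le> ?m" using Max_ge[OF finite_first_row, of y w] by linarith
    moreover have "v \<noteq> ?m" using m that distinct_bumped[OF assms(1)] by auto
    ultimately show ?thesis by simp
  qed
  then have "filter (\<lambda>v. v < ?m) (bumped w) = bumped w" by (simp add: filter_id_conv)
  moreover have "filter (\<lambda>v. v < z) w = w" "filter (\<lambda>v. v < z) (bumped w) = bumped w"
    using lt Un by (simp_all add: filter_id_conv)
  ultimately show ?thesis
    using chain_len_filter_less_bumped[OF assms(1), of z] bz by simp
qed

section \<open>Tableaux and reverse insertion\<close>

text \<open>Rows are sets, read in decreasing order; columns decrease from row \<open>r\<close> to row \<open>r'\<close> below it iff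
  \<open>r'\<close> has at most as many entries \<open>\<ge> y\<close> as \<open>r\<close>, for all \<open>y\<close>.\<close>

definition row_dom :: "nat set \<Rightarrow> nat set \<Rightarrow> bool" where
  "row_dom r' r \<longleftrightarrow> (\<forall>y. card (r' \<inter> {y..}) \<le> card (r \<inter> {y..}))"

definition tableau :: "nat set \<Rightarrow> (nat \<Rightarrow> nat set) \<Rightarrow> bool" where
  "tableau X tab \<longleftrightarrow> finite X \<and> (\<Union>r. tab r) = X \<and> (\<forall>r s. r \<noteq> s \<longrightarrow> tab r \<inter> tab s = {}) \<and>
     (\<forall>r. row_dom (tab (Suc r)) (tab r))"

definition shape :: "(nat \<Rightarrow> nat set) \<Rightarrow> (nat \<times> nat) set" where
  "shape tab = {(r, c). c < card (tab r)}"

text \<open>The recursion runs on the index of the queried row and shifts the tableau, so the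
  bumping path is unrolled only as far as that row.\<close>

fun tab_insert :: "nat \<Rightarrow> (nat \<Rightarrow> nat set) \<Rightarrow> nat \<Rightarrow> nat set" where
  "tab_insert x tab 0 = row_insert x (tab 0)"
| "tab_insert x tab (Suc r) =
    (case bump x (tab 0) of None \<Rightarrow> tab (Suc r) | Some b \<Rightarrow> tab_insert b (\<lambda>r. tab (Suc r)) r)"

text \<open>\<open>P_tab\<close> sends the whole word through one row at a time,
  \<open>tab_insert\<close> sends one letter through all rows. The orders agree because the letter
  passed on to the next row is exactly the one that \<open>bumped\<close> puts in front.\<close>

lemma P_tab_Cons: "P_tab (x # w) = tab_insert x (P_tab w)"
proof
  show "P_tab (x # w) r = tab_insert x (P_tab w) r" for r
  proof (induction r arbitrary: x w)
    case 0
    then show ?case by (simp add: P_tab_def)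
  next
    case (Suc r)
    have shift: "P_tab v (Suc r) = P_tab (bumped v) r" for v r
      by (simp add: P_tab_def funpow_swap1)
    have P0: "P_tab w 0 = first_row w"
      by (simp add: P_tab_def)
    show ?case
      using Suc by (cases "bump x (first_row w)") (simp_all add: shift P0)
  qed
qed

text \<open>The formulas for \<open>x\<close> and \<open>r\<close> here and in
  \<open>row_insert_Some\<close> recover the inserted letter and the old row from the new row and
  the bumped letter, if any: one step of reverse insertion.\<close>

lemma row_insert_None:
  assumes "finite r" "x \<notin> r" "bump x r = None"
  shows "card (row_insert x r) = Suc (card r)" "x = Min (row_insert x r)" "r = row_insert x r - {x}"
proof -
  have eq: "row_insert x r = insert x r" using assms(3) by (simp add: row_insert_def)
  show "card (row_insert x r) = Suc (card r)" "r = row_insert x r - {x}"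
    using assms eq by auto
  have "Min (insert x r) = x"
    using assms by (intro Min_eqI) (auto simp: bump_None_iff not_less)
  then show "x = Min (row_insert x r)" using eq by simp
qed

lemma row_insert_Some:
  assumes "finite r" "x \<notin> r" "bump x r = Some b"
  shows "card (row_insert x r) = card r" "x = Min {y \<in> row_insert x r. b < y}"
    "r = insert b (row_insert x r - {x})" "b \<notin> row_insert x r"
proof -
  have b: "b \<in> r" "b < x" "\<forall>y\<in>r. y < x \<longrightarrow> y \<le> b"
    using assms bump_Some_iff by auto
  have eq: "row_insert x r = insert x (r - {b})" using assms(3) by (simp add: row_insert_def)
  show "card (row_insert x r) = card r"
    using assms eq card_Suc_Diff1[OF assms(1) b(1)] by simp
  show "r = insert b (row_insert x r - {x})" "b \<notin> row_insert x r"
    using assms b eq by auto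
  have "Min {y \<in> insert x (r - {b}). b < y} = x"
  proof (rule Min_eqI)
    show "x \<le> y" if "y \<in> {y \<in> insert x (r - {b}). b < y}" for y
      using that b(3) by (cases "y < x") auto
  qed (use assms b in auto)
  then show "x = Min {y \<in> row_insert x r. b < y}" using eq by simp
qed

section \<open>Insertion preserves the column condition\<close>

lemma row_dom_row_insert:
  assumes "finite r" "finite r'" "row_dom r' r" "x \<notin> r" "bump x r = Some b" "b \<notin> r'"
  shows "row_dom (row_insert b r') (row_insert x r)"
  unfolding row_dom_def
proof
  fix y
  have b: "b \<in> r" "b < x" "\<forall>y\<in>r. y < x \<longrightarrow> y \<le> b"
    using assms bump_Some_iff by auto
  have eq: "row_insert x r = insert x (r - {b})" using assms(5) by (simp add: row_insert_def)
  have dom: "card (r' \<inter> {y..}) \<le> card (r \<inter> {y..})" for y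
    using assms(3) by (simp add: row_dom_def)
  have bS: "b' \<in> r'" "b' < b" "\<And>y. y \<in> r' \<Longrightarrow> y < b \<Longrightarrow> y \<le> b'" if "bump b r' = Some b'" for b'
    using that bump_Some_iff[OF assms(2), of b b'] by auto
  \<comment> \<open>Compare \<open>y\<close> with \<open>b\<close> and with the letter
    \<open>b'\<close> that \<open>b\<close> bumps in turn. Above \<open>b\<close> the lower row
    gains nothing; at or below \<open>b'\<close> each row trades one letter for another; in the
    remaining case \<open>r'\<close> has no letters from \<open>y\<close> up to \<open>b\<close>, so
    the bound at \<open>Suc b\<close> with one more letter on each side suffices.\<close>
  consider "b < y" | "y \<le> b" "\<exists>b'. bump b r' = Some b' \<and> y \<le> b'"
    | "y \<le> b" "\<not> (\<exists>b'. bump b r' = Some b' \<and> y \<le> b')"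
    by (cases "b < y"; cases "\<exists>b'. bump b r' = Some b' \<and> y \<le> b'") (auto simp: not_less)
  then show "card (row_insert b r' \<inter> {y..}) \<le> card (row_insert x r \<inter> {y..})"
  proof cases
    case 1
    have "row_insert b r' \<inter> {y..} = r' \<inter> {y..}"
    proof (cases "bump b r'")
      case (Some b')
      then show ?thesis using 1 bS(2)[OF Some] by (auto simp: row_insert_def)
    qed (use 1 in \<open>auto simp: row_insert_def\<close>)
    moreover have "card (r \<inter> {y..}) \<le> card (insert x (r - {b}) \<inter> {y..})"
      using assms(1) 1 by (intro card_mono) auto
    then have "card (r \<inter> {y..}) \<le> card (row_insert x r \<inter> {y..})"
      unfolding eq .
    ultimately show ?thesis using dom[of y] by simp
  next
    case 2
    then obtain b' where b': "bump b r' = Some b'" "y \<le> b'" by auto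
    have "b' \<in> r'" "b' < b" using b' bS by auto
    then have "row_insert b r' \<inter> {y..} = insert b (r' \<inter> {y..} - {b'})" "b' \<in> r' \<inter> {y..}"
      using 2 b' by (auto simp: row_insert_def)
    then have c1: "card (row_insert b r' \<inter> {y..}) = card (r' \<inter> {y..})"
      using assms(2,6) card_Suc_Diff1[of "r' \<inter> {y..}" b'] by simp
    have "row_insert x r \<inter> {y..} = insert x (r \<inter> {y..} - {b})" "b \<in> r \<inter> {y..}"
      using 2 b eq by auto
    then have "card (row_insert x r \<inter> {y..}) = card (r \<inter> {y..})"
      using assms(1,4) card_Suc_Diff1[of "r \<inter> {y..}" b] by simp
    then show ?thesis using c1 dom[of y] by simp
  next
    case 3
    have no: "z \<notin> r'" if "y \<le> z" "z < b" for z
    proof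
      assume "z \<in> r'"
      then have "bump b r' \<noteq> None" using that unfolding bump_None_iff by blast
      then obtain b' where b': "bump b r' = Some b'" by auto
      have "z \<le> b'" using bS(3)[OF b' \<open>z \<in> r'\<close> that(2)] .
      then have "y \<le> b'" using that(1) by simp
      then show False using 3(2) b' by simp
    qed
    have "row_insert b r' \<inter> {y..} \<subseteq> insert b (r' \<inter> {Suc b..})"
    proof
      fix z assume z: "z \<in> row_insert b r' \<inter> {y..}"
      then have "z = b \<or> z \<in> r'" by (auto simp: row_insert_def)
      then show "z \<in> insert b (r' \<inter> {Suc b..})"
        using no[of z] z by (cases z b rule: linorder_cases) auto
    qed
    then have "card (row_insert b r' \<inter> {y..}) \<le> card (insert b (r' \<inter> {Suc b..}))"
      using assms(2) by (intro card_mono) auto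
    also have "\<dots> = Suc (card (r' \<inter> {Suc b..}))" using assms(2) by simp
    also have "\<dots> \<le> Suc (card (r \<inter> {Suc b..}))" using dom by simp
    also have "\<dots> = card (insert x (r \<inter> {Suc b..}))" using assms(1,4) by simp
    also have "\<dots> \<le> card (row_insert x r \<inter> {y..})"
      using assms(1) eq 3 b by (intro card_mono) auto
    finally show ?thesis .
  qed
qed

lemma row_dom_mono:
  assumes "row_dom r' r" "r \<subseteq> s" "finite s"
  shows "row_dom r' s"
  unfolding row_dom_def
proof
  fix y
  have "card (r \<inter> {y..}) \<le> card (s \<inter> {y..})" using assms by (intro card_mono) auto
  then show "card (r' \<inter> {y..}) \<le> card (s \<inter> {y..})"
    using assms(1) unfolding row_dom_def by (metis order_trans)
qed

lemma row_dom_card: "row_dom r' r \<Longrightarrow> card r' \<le> card r"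
  unfolding row_dom_def by (metis atLeast_0 inf_top_right)

lemma first_row_subset: "first_row w \<subseteq> set w"
  and set_bumped_subset: "set (bumped w) \<subseteq> set w"
  by (subst set_eq_first_row_bumped[of w]; blast)+

lemma row_dom_bumped:
  assumes "distinct w"
  shows "row_dom (first_row (bumped w)) (first_row w)"
  using assms
proof (induction w)
  case (Cons x w)
  then have IH: "row_dom (first_row (bumped w)) (first_row w)" by simp
  have x: "x \<notin> first_row w" using Cons.prems set_eq_first_row_bumped[of w] by auto
  show ?case
  proof (cases "bump x (first_row w)")
    case None
    then show ?thesis
      using IH finite_first_row by (auto simp: row_insert_def intro: row_dom_mono)
  next
    case (Some b)
    have "b \<notin> first_row (bumped w)"
      using Some Cons.prems distinct_bumped[of w] first_row_subset[of "bumped w"]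
        bump_Some_iff[OF finite_first_row, of x w b] by auto
    then show ?thesis
      using row_dom_row_insert[OF finite_first_row finite_first_row IH x Some] Some by simp
  qed
qed (simp add: row_dom_def)

section \<open>The tableau of a word and its shape\<close>

lemma funpow_bumped:
  assumes "distinct w"
  shows "distinct ((bumped ^^ r) w)" "r \<le> s \<Longrightarrow> set ((bumped ^^ s) w) \<subseteq> set ((bumped ^^ r) w)"
proof -
  show d: "distinct ((bumped ^^ r) w)" for r
    by (induction r) (use assms distinct_bumped in auto)
  show "r \<le> s \<Longrightarrow> set ((bumped ^^ s) w) \<subseteq> set ((bumped ^^ r) w)"
    by (induction s rule: dec_induct) (use set_bumped_subset in auto)
qed

lemma funpow_bumped_length: "(bumped ^^ length w) w = []"
proof -
  have "length ((bumped ^^ r) w) \<le> length w - r" for r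
  proof (induction r)
    case (Suc r)
    then show ?case using length_bumped[of "(bumped ^^ r) w"] by simp
  qed simp
  from this[of "length w"] show ?thesis by simp
qed

lemma tableau_P_tab:
  assumes "distinct w"
  shows "tableau (set w) (P_tab w)"
proof -
  have disj: "P_tab w r \<inter> P_tab w s = {}" if "r < s" for r s
  proof -
    have "P_tab w s \<subseteq> set ((bumped ^^ s) w)"
      using first_row_subset by (auto simp: P_tab_def)
    also have "\<dots> \<subseteq> set ((bumped ^^ Suc r) w)"
      using funpow_bumped(2)[OF assms, of "Suc r" s] that by simp
    finally show ?thesis
      using distinct_bumped[OF funpow_bumped(1)[OF assms, of r]] by (auto simp: P_tab_def)
  qed
  have "set w = (\<Union>s<r. P_tab w s) \<union> set ((bumped ^^ r) w)" for r
  proof (induction r)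
    case (Suc r)
    then show ?case
      using set_eq_first_row_bumped[of "(bumped ^^ r) w"]
      by (auto simp: P_tab_def lessThan_Suc)
  qed simp
  from this[of "length w"] have "set w \<subseteq> (\<Union>s. P_tab w s)"
    by (auto simp: funpow_bumped_length)
  moreover have "P_tab w s \<subseteq> set w" for s
    using first_row_subset[of "(bumped ^^ s) w"] funpow_bumped(2)[OF assms, of 0 s]
    by (auto simp: P_tab_def)
  ultimately have "(\<Union>s. P_tab w s) = set w" by blast
  moreover have "row_dom (P_tab w (Suc r)) (P_tab w r)" for r
    using row_dom_bumped[OF funpow_bumped(1)[OF assms, of r]] by (simp add: P_tab_def)
  moreover have "P_tab w r \<inter> P_tab w s = {}" if "r \<noteq> s" for r s
    using that disj[of r s] disj[of s r] by (cases "r < s") auto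
  ultimately show ?thesis by (simp add: tableau_def)
qed

lemma tableau_card_antimono:
  assumes "tableau X tab" "r \<le> s"
  shows "card (tab s) \<le> card (tab r)"
  using assms(2)
proof (induction s rule: dec_induct)
  case (step s)
  have "card (tab (Suc s)) \<le> card (tab s)"
    using assms(1) unfolding tableau_def by (intro row_dom_card) blast
  then show ?case using step by simp
qed simp

text \<open>Each application of \<open>bumped\<close> to a nonempty word lowers the longest
  increasing chain by one; truncated subtraction covers the rows after the word is
  exhausted.\<close>

lemma P_tab_nonempty_iff:
  assumes "distinct w"
  shows "P_tab w r \<noteq> {} \<longleftrightarrow> r < chain_len (<) w"
proof -
  have len: "chain_len (<) ((bumped ^^ r) w) = chain_len (<) w - r"
  proof (induction r)
    case (Suc r)
    show ?case
    proof (cases "(bumped ^^ r) w = []")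
      case True
      then show ?thesis using Suc by simp
    next
      case False
      from chain_len_bumped[OF funpow_bumped(1)[OF assms] this] Suc show ?thesis by simp
    qed
  qed simp
  have "v \<noteq> [] \<longleftrightarrow> 0 < chain_len (<) v" for v by (cases v) auto
  from this[of "(bumped ^^ r) w"] show ?thesis
    unfolding len P_tab_def first_row_empty_iff by simp
qed

lemma tableau_finite: "tableau X tab \<Longrightarrow> finite (tab r)"
  by (rule finite_subset[of _ X]) (auto simp: tableau_def)

text \<open>Row lengths decrease weakly, so containment in the box is decided by the first row,
  whose length is that of a longest decreasing chain, and by the number of nonempty rows, which is
  that of a longest increasing one.\<close>

lemma shape_P_tab_subset_iff:
  assumes "distinct w"
  shows "shape (P_tab w) \<subseteq> {..<i} \<times> {..<j} \<longleftrightarrow> chain_len (<) w \<le> i \<and> chain_len (>) w \<le> j"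
proof
  have c0: "card (P_tab w 0) = chain_len (>) w"
    using card_first_row[OF assms] by (simp add: P_tab_def)
  note tab = tableau_P_tab[OF assms]
  show "chain_len (<) w \<le> i \<and> chain_len (>) w \<le> j"
    if sub: "shape (P_tab w) \<subseteq> {..<i} \<times> {..<j}"
  proof
    show "chain_len (<) w \<le> i"
    proof (rule ccontr)
      assume "\<not> chain_len (<) w \<le> i"
      then have "P_tab w i \<noteq> {}" using P_tab_nonempty_iff[OF assms] by simp
      then have "(i, 0) \<in> shape (P_tab w)"
        using tableau_finite[OF tab] by (simp add: shape_def card_gt_0_iff)
      then show False using sub by auto
    qed
    show "chain_len (>) w \<le> j"
    proof (rule ccontr)
      assume "\<not> chain_len (>) w \<le> j"
      then have "(0, j) \<in> shape (P_tab w)" using c0 by (simp add: shape_def)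
      then show False using sub by auto
    qed
  qed
  show "shape (P_tab w) \<subseteq> {..<i} \<times> {..<j}" if le: "chain_len (<) w \<le> i \<and> chain_len (>) w \<le> j"
  proof (clarsimp simp: shape_def)
    fix r c assume c: "c < card (P_tab w r)"
    then have "P_tab w r \<noteq> {}" by auto
    then have "r < i" using P_tab_nonempty_iff[OF assms] le by auto
    moreover have "c < j" using c c0 le tableau_card_antimono[OF tab, of 0 r] by simp
    ultimately show "r < i \<and> c < j" by simp
  qed
qed

section \<open>Peeling off rows and inverting insertion\<close>

lemma UN_nat_split: "(\<Union>s. f s) = f 0 \<union> (\<Union>s. f (Suc s))" for f :: "nat \<Rightarrow> 'a set"
proof (intro equalityI subsetI)
  fix v assume "v \<in> (\<Union>s. f s)"
  then obtain s where "v \<in> f s" by blast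
  then show "v \<in> f 0 \<union> (\<Union>s. f (Suc s))" by (cases s) auto
qed auto

text \<open>Used in both directions: to pass to the lower rows in an induction, and to put a
  modified first row on top of a tableau already obtained for them.\<close>

lemma tableau_case_nat:
  "tableau X (case_nat r tab) \<longleftrightarrow> finite X \<and> r \<subseteq> X \<and> row_dom (tab 0) r \<and> tableau (X - r) tab"
proof
  assume t: "tableau X (case_nat r tab)"
  have U: "X = r \<union> (\<Union>s. tab s)"
  proof -
    have "X = (\<Union>s. case_nat r tab s)" using t by (simp add: tableau_def)
    also have "\<dots> = r \<union> (\<Union>s. tab s)"
      by (subst UN_nat_split) simp
    finally show ?thesis .
  qed
  have d: "case_nat r tab s \<inter> case_nat r tab s' = {}" if "s \<noteq> s'" for s s'
    using t that by (simp add: tableau_def)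
  have "tab s \<inter> tab s' = {}" if "s \<noteq> s'" for s s' using d[of "Suc s" "Suc s'"] that by simp
  moreover have "r \<inter> tab s = {}" for s using d[of 0 "Suc s"] by simp
  then have "(\<Union>s. tab s) = X - r" using U by blast
  moreover have dom: "row_dom (case_nat r tab (Suc s)) (case_nat r tab s)" for s
    using t by (simp add: tableau_def)
  have "row_dom (tab (Suc s)) (tab s)" for s using dom[of "Suc s"] by simp
  moreover have "finite X" using t by (simp add: tableau_def)
  ultimately show "finite X \<and> r \<subseteq> X \<and> row_dom (tab 0) r \<and> tableau (X - r) tab"
    using dom[of 0] U by (simp add: tableau_def)
next
  assume a: "finite X \<and> r \<subseteq> X \<and> row_dom (tab 0) r \<and> tableau (X - r) tab"
  then have U: "(\<Union>s. tab s) = X - r" by (simp add: tableau_def)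
  have "(\<Union>s. case_nat r tab s) = r \<union> (\<Union>s. tab s)"
    by (subst UN_nat_split) simp
  then have "(\<Union>s. case_nat r tab s) = X" using a by (simp only: U Diff_partition)
  moreover have "row_dom (case_nat r tab (Suc s)) (case_nat r tab s)" for s
    using a by (cases s) (simp_all add: tableau_def)
  moreover have "case_nat r tab s \<inter> case_nat r tab s' = {}" if "s \<noteq> s'" for s s'
  proof -
    have "tab s \<subseteq> X - r" for s unfolding U[symmetric] by auto
    then have "r \<inter> tab s = {}" for s by fast
    then show ?thesis
      using a that by (cases s; cases s') (auto simp: tableau_def)
  qed
  ultimately show "tableau X (case_nat r tab)" using a by (simp add: tableau_def)
qed

lemma tableau_tail:
  assumes "tableau X tab"
  shows "finite X" "tab 0 \<subseteq> X" "row_dom (tab (Suc 0)) (tab 0)"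
    "tableau (X - tab 0) (\<lambda>r. tab (Suc r))"
proof -
  have "case_nat (tab 0) (\<lambda>r. tab (Suc r)) = tab"
    by (rule ext) (auto split: nat.split)
  then show "finite X" "tab 0 \<subseteq> X" "row_dom (tab (Suc 0)) (tab 0)"
    "tableau (X - tab 0) (\<lambda>r. tab (Suc r))"
    using assms tableau_case_nat[of X "tab 0" "\<lambda>r. tab (Suc r)"] by simp_all
qed

text \<open>When a letter is bumped, the first row is nonempty and the lower rows hold fewer
  letters. Induction on the number of letters shows that the bumping path ends, and the row where it
  ends is the only one that grows.\<close>

lemma card_tab_insert:
  assumes "tableau X tab" "x \<notin> X"
  shows "\<exists>R. \<forall>r. card (tab_insert x tab r) = card (tab r) + (if r = R then 1 else 0)"
  using assms
proof (induction "card X" arbitrary: X tab x rule: less_induct)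
  case less
  have t: "finite X" "tab 0 \<subseteq> X" "tableau (X - tab 0) (\<lambda>r. tab (Suc r))"
    using tableau_tail[OF less.prems(1)] by simp_all
  have fx: "finite (tab 0)" "x \<notin> tab 0" using t less.prems finite_subset by auto
  show ?case
  proof (cases "bump x (tab 0)")
    case None
    have "card (tab_insert x tab r) = card (tab r) + (if r = 0 then 1 else 0)" for r
      using row_insert_None(1)[OF fx None] None by (cases r) auto
    then show ?thesis by blast
  next
    case (Some b)
    have b: "b \<in> tab 0" using bump_Some_iff[OF fx(1), of x b] Some by simp
    have "card (X - tab 0) < card X"
      using t b by (intro psubset_card_mono) auto
    then obtain R where R: "\<forall>r. card (tab_insert b (\<lambda>r. tab (Suc r)) r) = card (tab (Suc r)) + (if r = R then 1 else 0)"
      using less.hyps[OF _ t(3), of b] b by auto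
    have "card (tab_insert x tab r) = card (tab r) + (if r = Suc R then 1 else 0)" for r
      using row_insert_Some(1)[OF fx Some] R Some by (cases r) auto
    then show ?thesis by blast
  qed
qed

text \<open>Fixing the row \<open>R\<close> of the new cell makes insertion reversible.
  \<open>R = 0\<close> means that nothing was bumped, so the letter is the minimum of the new row;
  otherwise the lower rows determine the bumped letter, and the inserted one is the smallest entry
  above it.\<close>

lemma tab_insert_inject:
  assumes "tableau X tab" "x \<notin> X" "tableau X' tab'" "x' \<notin> X'"
    and "tab_insert x tab = tab_insert x' tab'"
    and "\<And>r. card (tab_insert x tab r) = card (tab r) + (if r = R then 1 else 0)"
    and "\<And>r. card (tab_insert x' tab' r) = card (tab' r) + (if r = R then 1 else 0)"
  shows "x = x' \<and> tab = tab'"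
  using assms
proof (induction R arbitrary: X tab x X' tab' x')
  case 0
  have t: "finite (tab 0)" "x \<notin> tab 0" "finite (tab' 0)" "x' \<notin> tab' 0"
    using 0(1-4) tableau_finite by (auto simp: tableau_def)
  have N: "bump x (tab 0) = None" "bump x' (tab' 0) = None"
    using row_insert_Some(1)[OF t(1,2)] row_insert_Some(1)[OF t(3,4)] 0(6)[of 0] 0(7)[of 0]
    by (cases "bump x (tab 0)"; cases "bump x' (tab' 0)"; simp)+
  have eq: "row_insert x (tab 0) = row_insert x' (tab' 0)"
    using fun_cong[OF 0(5), of 0] by simp
  have "x = x'"
    using row_insert_None(2)[OF t(1,2) N(1)] row_insert_None(2)[OF t(3,4) N(2)] eq by simp
  moreover have "tab 0 = tab' 0"
    using row_insert_None(3)[OF t(1,2) N(1)] row_insert_None(3)[OF t(3,4) N(2)] eq calculation by simp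
  moreover have "tab (Suc r) = tab' (Suc r)" for r
    using fun_cong[OF 0(5), of "Suc r"] N by simp
  ultimately have "tab r = tab' r" for r by (cases r) auto
  then show ?case using \<open>x = x'\<close> by auto
next
  case (Suc R)
  have t: "finite (tab 0)" "x \<notin> tab 0" "finite (tab' 0)" "x' \<notin> tab' 0"
    using Suc.prems(1-4) tableau_finite by (auto simp: tableau_def)
  obtain b b' where S: "bump x (tab 0) = Some b" "bump x' (tab' 0) = Some b'"
    using row_insert_None(1)[OF t(1,2)] row_insert_None(1)[OF t(3,4)] Suc.prems(6)[of 0] Suc.prems(7)[of 0]
    by (cases "bump x (tab 0)"; cases "bump x' (tab' 0)"; simp)
  have mem: "b \<in> tab 0" "b' \<in> tab' 0"
    using S bump_Some_iff[OF t(1), of x b] bump_Some_iff[OF t(3), of x' b'] by auto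
  have tl: "tableau (X - tab 0) (\<lambda>r. tab (Suc r))" "tableau (X' - tab' 0) (\<lambda>r. tab' (Suc r))"
    using tableau_tail(4)[OF Suc.prems(1)] tableau_tail(4)[OF Suc.prems(3)] .
  have ins: "tab_insert b (\<lambda>r. tab (Suc r)) r = tab_insert x tab (Suc r)"
    "tab_insert b' (\<lambda>r. tab' (Suc r)) r = tab_insert x' tab' (Suc r)" for r
    using S by simp_all
  have IH: "b = b' \<and> (\<lambda>r. tab (Suc r)) = (\<lambda>r. tab' (Suc r))"
  proof (rule Suc.IH[OF tl(1) _ tl(2)])
    show "tab_insert b (\<lambda>r. tab (Suc r)) = tab_insert b' (\<lambda>r. tab' (Suc r))"
      using ins Suc.prems(5) by auto
    show "card (tab_insert b (\<lambda>r. tab (Suc r)) r) = card (tab (Suc r)) + (if r = R then 1 else 0)" for r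
      unfolding ins using Suc.prems(6)[of "Suc r"] by simp
    show "card (tab_insert b' (\<lambda>r. tab' (Suc r)) r) = card (tab' (Suc r)) + (if r = R then 1 else 0)" for r
      unfolding ins using Suc.prems(7)[of "Suc r"] by simp
  qed (use mem in auto)
  then have bb: "b = b'" by simp
  have eq: "row_insert x (tab 0) = row_insert x' (tab' 0)"
    using fun_cong[OF Suc.prems(5), of 0] by simp
  have "x = x'"
    using row_insert_Some(2)[OF t(1,2) S(1)] row_insert_Some(2)[OF t(3,4) S(2)] eq bb by simp
  moreover have "tab 0 = tab' 0"
    using row_insert_Some(3)[OF t(1,2) S(1)] row_insert_Some(3)[OF t(3,4) S(2)] eq bb calculation by simp
  moreover have "tab (Suc r) = tab' (Suc r)" for r
    using IH fun_cong by meson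
  ultimately have "tab r = tab' r" for r by (cases r) auto
  then show ?case using \<open>x = x'\<close> by auto
qed

text \<open>Only thresholds up to the minimum see the removal; there the whole rows are compared,
  and strictness leaves room for one entry.\<close>

lemma row_dom_remove_Min:
  assumes "finite r" "finite r'" "row_dom r' r" "card r' < card r"
  shows "row_dom r' (r - {Min r})"
  unfolding row_dom_def
proof
  fix y
  have ne: "r \<noteq> {}" using assms(4) by auto
  show "card (r' \<inter> {y..}) \<le> card ((r - {Min r}) \<inter> {y..})"
  proof (cases "y \<le> Min r")
    case True
    then have "(r - {Min r}) \<inter> {y..} = r - {Min r}"
      using Min_le[OF assms(1)] order_trans by fastforce
    moreover have "card (r - {Min r}) = card r - 1" using assms(1) ne by simp
    moreover have "card (r' \<inter> {y..}) \<le> card r'" using assms(2) by (intro card_mono) auto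
    ultimately show ?thesis using assms(4) by simp
  next
    case False
    then have "(r - {Min r}) \<inter> {y..} = r \<inter> {y..}" by auto
    then show ?thesis using assms(3) by (simp add: row_dom_def)
  qed
qed

text \<open>Undoes one bump: \<open>b\<close> returns to the row above and evicts the smallest
  larger entry. Such an entry exists because \<open>b\<close> stands in the row below, so the column
  condition at threshold \<open>b\<close> forces an entry of \<open>s\<close> that is at least
  \<open>b\<close>.\<close>

lemma row_dom_reverse_bump:
  assumes "finite s" "finite r'" "row_dom (row_insert b r') s" "b \<notin> s" "b \<notin> r'"
    and x: "x = Min {y \<in> s. b < y}"
  shows "x \<in> s" "b < x" "row_dom r' (insert b (s - {x}))"
    and "bump x (insert b (s - {x})) = Some b" "row_insert x (insert b (s - {x})) = s"
proof -
  have dom: "card (row_insert b r' \<inter> {y..}) \<le> card (s \<inter> {y..})" for y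
    using assms(3) by (simp add: row_dom_def)
  have mem: "b \<in> row_insert b r'" by (simp add: row_insert_def)
  have fin: "finite (row_insert b r')" using assms(2) by (rule finite_row_insert)
  have "0 < card (row_insert b r' \<inter> {b..})"
    using mem fin by (auto simp: card_gt_0_iff)
  then have "s \<inter> {b..} \<noteq> {}" using dom[of b] by auto
  then have ne: "{y \<in> s. b < y} \<noteq> {}" using assms(4) by (auto simp: le_less)
  have "x \<in> {y \<in> s. b < y}" unfolding x using assms(1) ne by (intro Min_in) auto
  then show xs: "x \<in> s" "b < x" by auto
  have least: "x \<le> y" if "y \<in> s" "b < y" for y
    unfolding x using assms(1) that by (intro Min_le) auto
  show bmp: "bump x (insert b (s - {x})) = Some b"
  proof -
    have "y \<le> b" if "y \<in> s" "y < x" for y using least[of y] that by (cases "b < y") auto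
    then show ?thesis using assms(1) xs by (subst bump_Some_iff) auto
  qed
  show "row_insert x (insert b (s - {x})) = s"
    unfolding row_insert_def bmp using xs assms(4) by auto
  have le: "card (r' \<inter> {y..}) \<le> card (row_insert b r' \<inter> {y..})" for y
  proof (cases "bump b r'")
    case None
    then show ?thesis using fin by (intro card_mono) (auto simp: row_insert_def)
  next
    case (Some b')
    have b': "b' \<in> r'" "b' < b" using bump_Some_iff[OF assms(2), of b b'] Some by auto
    have eq: "row_insert b r' = insert b (r' - {b'})" using Some by (simp add: row_insert_def)
    show ?thesis
    proof (cases "y \<le> b'")
      case True
      then have "insert b (r' - {b'}) \<inter> {y..} = insert b (r' \<inter> {y..} - {b'})" "b' \<in> r' \<inter> {y..}"
        using b' by auto
      then have "card (insert b (r' - {b'}) \<inter> {y..}) = card (r' \<inter> {y..})"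
        using assms(2,5) card_Suc_Diff1[of "r' \<inter> {y..}" b'] by simp
      then show ?thesis unfolding eq by simp
    next
      case False
      then show ?thesis unfolding eq using assms(2) by (intro card_mono) auto
    qed
  qed
  show "row_dom r' (insert b (s - {x}))"
    unfolding row_dom_def
  proof
    fix y
    consider "x < y" | "y \<le> b" | "b < y" "y \<le> x" by linarith
    then show "card (r' \<inter> {y..}) \<le> card (insert b (s - {x}) \<inter> {y..})"
    proof cases
      case 1
      then have "insert b (s - {x}) \<inter> {y..} = s \<inter> {y..}" using xs by auto
      then show ?thesis using le[of y] dom[of y] by simp
    next
      case 2
      then have "insert b (s - {x}) \<inter> {y..} = insert b (s \<inter> {y..} - {x})" "x \<in> s \<inter> {y..}"
        using xs by auto
      then have "card (insert b (s - {x}) \<inter> {y..}) = card (s \<inter> {y..})"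
        using assms(1,4) card_Suc_Diff1[of "s \<inter> {y..}" x] by simp
      then show ?thesis using le[of y] dom[of y] by simp
    next
      \<comment> \<open>\<open>s\<close> has no entries from \<open>b\<close> up to
        \<open>x\<close>, so the new row counts one less than \<open>s\<close> does at threshold
        \<open>b\<close>; correspondingly, \<open>r'\<close> lacks the letter
        \<open>b\<close>.\<close>
      case 3
      have "insert b (s - {x}) \<inter> {y..} = s \<inter> {b..} - {x}"
      proof -
        have "y \<le> z" if "z \<in> s" "b \<le> z" for z
          using least[of z] that 3 assms(4) by (cases "z = b") auto
        then show ?thesis using 3 by auto
      qed
      then have c: "card (insert b (s - {x}) \<inter> {y..}) = card (s \<inter> {b..}) - 1"
        using xs assms(1) by simp
      have "r' \<inter> {y..} \<subseteq> (row_insert b r' \<inter> {b..}) - {b}"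
      proof -
        have "b' < b" if "bump b r' = Some b'" for b'
          using that bump_Some_iff[OF assms(2), of b b'] by simp
        then show ?thesis using 3 by (cases "bump b r'") (auto simp: row_insert_def)
      qed
      then have "card (r' \<inter> {y..}) \<le> card ((row_insert b r' \<inter> {b..}) - {b})"
        using fin by (intro card_mono) auto
      also have "\<dots> = card (row_insert b r' \<inter> {b..}) - 1" using mem fin by simp
      finally show ?thesis using c dom[of b] by simp
    qed
  qed
qed

text \<open>Reverse insertion can start in any row that is strictly longer than the next. In row 0
  the minimum leaves; deeper down, the lower rows first release a letter \<open>b\<close>, which
  then takes the place of an entry of the first row.\<close>

lemma tab_insert_surj:
  assumes "tableau X tab" "card (tab (Suc R)) < card (tab R)"
  shows "\<exists>x tab0. x \<in> X \<and> tableau (X - {x}) tab0 \<and> tab_insert x tab0 = tab \<and>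
    (\<forall>r. card (tab r) = card (tab0 r) + (if r = R then 1 else 0))"
  using assms
proof (induction R arbitrary: X tab)
  case 0
  define x where "x = Min (tab 0)"
  define tab0 where "tab0 = case_nat (tab 0 - {x}) (\<lambda>r. tab (Suc r))"
  have t: "finite X" "tab 0 \<subseteq> X" "row_dom (tab (Suc 0)) (tab 0)" "tableau (X - tab 0) (\<lambda>r. tab (Suc r))"
    using tableau_tail[OF 0(1)] .
  have fin: "finite (tab r)" for r using tableau_finite[OF 0(1)] .
  have ne: "tab 0 \<noteq> {}" using 0(2) by auto
  have x: "x \<in> tab 0" unfolding x_def using fin ne by (rule Min_in)
  have "X - {x} - (tab 0 - {x}) = X - tab 0" using x by auto
  then have "tableau (X - {x}) tab0"
    unfolding tab0_def tableau_case_nat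
    using t row_dom_remove_Min[OF fin fin t(3) 0(2)] by (auto simp: x_def)
  moreover have N: "bump x (tab 0 - {x}) = None"
    unfolding bump_None_iff using Min_le[OF fin[of 0]] by (auto simp: x_def not_less)
  then have ins: "tab_insert x tab0 r = tab r" for r
    using x by (cases r) (auto simp: tab0_def row_insert_def)
  moreover have "card (tab r) = card (tab0 r) + (if r = 0 then 1 else 0)" for r
    using x fin card_Suc_Diff1[OF fin x] by (cases r) (auto simp: tab0_def)
  ultimately show ?case using x t(2) by blast
next
  case (Suc R)
  have t: "finite X" "tab 0 \<subseteq> X" "row_dom (tab (Suc 0)) (tab 0)" "tableau (X - tab 0) (\<lambda>r. tab (Suc r))"
    using tableau_tail[OF Suc.prems(1)] .
  have fin: "finite (tab r)" for r using tableau_finite[OF Suc.prems(1)] .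
  obtain b tab1 where b: "b \<in> X - tab 0" "tableau (X - tab 0 - {b}) tab1"
    "tab_insert b tab1 = (\<lambda>r. tab (Suc r))"
    "\<forall>r. card (tab (Suc r)) = card (tab1 r) + (if r = R then 1 else 0)"
    using Suc.IH[OF t(4) Suc.prems(2)] by blast
  have b1: "b \<notin> tab1 0" using b(2) by (auto simp: tableau_def)
  have tab1: "tab (Suc 0) = row_insert b (tab1 0)" using fun_cong[OF b(3), of 0] by simp
  define x where "x = Min {y \<in> tab 0. b < y}"
  note rev = row_dom_reverse_bump[OF fin[of 0] tableau_finite[OF b(2), of 0] t(3)[unfolded tab1] _ b1 x_def]
  have b0: "b \<notin> tab 0" using b(1) by simp
  note rev = rev[OF b0]
  define tab0 where "tab0 = case_nat (insert b (tab 0 - {x})) tab1"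
  have "X - {x} - insert b (tab 0 - {x}) = X - tab 0 - {b}" using rev(1) by auto
  then have "tableau (X - {x}) tab0"
    unfolding tab0_def tableau_case_nat
    using t b rev(1-3) by auto
  moreover have ins: "tab_insert x tab0 r = tab r" for r
    using rev(4,5) fun_cong[OF b(3)] by (cases r) (auto simp: tab0_def)
  moreover have "card (tab r) = card (tab0 r) + (if r = Suc R then 1 else 0)" for r
    using rev(1) b0 fin card_Suc_Diff1[OF fin rev(1)] b(4) by (cases r) (auto simp: tab0_def)
  ultimately show ?case using rev(1) t(2) by blast
qed

section \<open>Oscillating tableaux\<close>

definition diagram :: "(nat \<times> nat) set \<Rightarrow> bool" where
  "diagram lam \<longleftrightarrow> (\<forall>r c. (Suc r, c) \<in> lam \<longrightarrow> (r, c) \<in> lam) \<and> (\<forall>r c. (r, Suc c) \<in> lam \<longrightarrow> (r, c) \<in> lam)"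

definition removable :: "(nat \<times> nat) set \<Rightarrow> (nat \<times> nat) set" where
  "removable lam = {p \<in> lam. diagram (lam - {p})}"

definition addable :: "(nat \<times> nat) set \<Rightarrow> (nat \<times> nat) set" where
  "addable lam = {p. p \<notin> lam \<and> diagram (insert p lam)}"

text \<open>Counts sequences of diagrams from the empty one at time 0 to \<open>lam\<close> at time
  \<open>t\<close>. The recursion undoes the last step, so at a time in \<open>U\<close>, where a
  cell appears, it removes one, and at a time in \<open>V\<close> it adds one. The box is tested
  only after a growth step because a loss cannot leave it.\<close>

fun oscillating :: "nat \<Rightarrow> nat \<Rightarrow> nat set \<Rightarrow> nat set \<Rightarrow> nat \<Rightarrow> (nat \<times> nat) set \<Rightarrow> nat" where
  "oscillating i j U V 0 lam = (if lam = {} then 1 else 0)"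
| "oscillating i j U V (Suc t) lam =
    (if t \<in> U then
       (if lam \<subseteq> {..<i} \<times> {..<j} then \<Sum>p\<in>removable lam. oscillating i j U V t (lam - {p}) else 0)
     else if t \<in> V then \<Sum>p\<in>addable lam. oscillating i j U V t (insert p lam)
     else oscillating i j U V t lam)"

lemma swap_image_Diff: "prod.swap ` (A - {p}) = prod.swap ` A - {prod.swap p}"
  by (simp add: image_set_diff)

lemma swap_mem: "prod.swap p \<in> prod.swap ` A \<longleftrightarrow> p \<in> A"
  by (simp add: inj_image_mem_iff)

lemma diagram_swap: "diagram (prod.swap ` lam) = diagram lam"
proof -
  have "(r, c) \<in> prod.swap ` lam \<longleftrightarrow> (c, r) \<in> lam" for r c
    using swap_mem[of "(c, r)" lam] by simp
  then show ?thesis by (auto simp: diagram_def)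
qed

lemma removable_swap: "removable (prod.swap ` lam) = prod.swap ` removable lam"
proof -
  have "prod.swap q \<in> removable (prod.swap ` lam) \<longleftrightarrow> prod.swap q \<in> prod.swap ` removable lam" for q
    unfolding removable_def swap_mem mem_Collect_eq swap_image_Diff[symmetric] diagram_swap ..
  then show ?thesis by (metis equalityI subsetI swap_swap)
qed

lemma addable_swap: "addable (prod.swap ` lam) = prod.swap ` addable lam"
proof -
  have "prod.swap q \<in> addable (prod.swap ` lam) \<longleftrightarrow> prod.swap q \<in> prod.swap ` addable lam" for q
    unfolding addable_def swap_mem mem_Collect_eq image_insert[symmetric] diagram_swap ..
  then show ?thesis by (metis equalityI subsetI swap_swap)
qed

text \<open>Transposition carries removable cells to removable cells, addable cells to addable cells
  and the i by j box to the j by i box, while the event times stay fixed.\<close>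

lemma oscillating_swap: "oscillating i j U V t (prod.swap ` lam) = oscillating j i U V t lam"
proof (induction t arbitrary: lam)
  case (Suc t)
  have box: "prod.swap ` lam \<subseteq> {..<i} \<times> {..<j} \<longleftrightarrow> lam \<subseteq> {..<j} \<times> {..<i}"
    by (auto simp: subset_iff)
  have "(\<Sum>p\<in>removable (prod.swap ` lam). oscillating i j U V t (prod.swap ` lam - {p})) =
      (\<Sum>p\<in>removable lam. oscillating j i U V t (lam - {p}))"
    unfolding removable_swap by (simp add: sum.reindex swap_image_Diff[symmetric] Suc.IH)
  moreover have "(\<Sum>p\<in>addable (prod.swap ` lam). oscillating i j U V t (insert p (prod.swap ` lam))) =
      (\<Sum>p\<in>addable lam. oscillating j i U V t (insert p lam))"
    unfolding addable_swap
    by (simp add: sum.reindex image_insert[symmetric] Suc.IH del: image_insert)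
  ultimately show ?case using box Suc.IH by simp
qed simp

section \<open>Corners of the shape of a tableau\<close>

lemma shape_decrement:
  assumes "\<And>r. card (tab r) = card (tab0 r) + (if r = R then 1 else 0)"
  shows "shape tab0 = shape tab - {(R, card (tab R) - 1)}"
  using assms by (auto simp: shape_def split: if_splits)

lemma diagram_shape_iff: "diagram (shape tab) \<longleftrightarrow> (\<forall>r. card (tab (Suc r)) \<le> card (tab r))"
proof
  assume d: "diagram (shape tab)"
  show "\<forall>r. card (tab (Suc r)) \<le> card (tab r)"
  proof (rule allI, rule ccontr)
    fix r assume "\<not> card (tab (Suc r)) \<le> card (tab r)"
    then have "(Suc r, card (tab r)) \<in> shape tab" by (simp add: shape_def)
    then have "(r, card (tab r)) \<in> shape tab" using d unfolding diagram_def by blast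
    then show False by (simp add: shape_def)
  qed
qed (auto simp: diagram_def shape_def intro: less_le_trans)

text \<open>That dropping the last cell of such a row leaves a diagram is read off from reverse
  insertion, which yields a tableau of that shape.\<close>

lemma removable_shape:
  assumes "tableau X tab"
  shows "removable (shape tab) = (\<lambda>R. (R, card (tab R) - 1)) ` {R. card (tab (Suc R)) < card (tab R)}"
proof (intro equalityI subsetI)
  fix p assume p: "p \<in> removable (shape tab)"
  obtain R c where pe: "p = (R, c)" by force
  have c: "c < card (tab R)" and d: "diagram (shape tab - {(R, c)})"
    using p by (auto simp: removable_def pe shape_def)
  have "(R, Suc c) \<notin> shape tab"
  proof
    assume "(R, Suc c) \<in> shape tab"
    then have "(R, Suc c) \<in> shape tab - {(R, c)}" by simp
    then have "(R, c) \<in> shape tab - {(R, c)}" using d unfolding diagram_def by blast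
    then show False by simp
  qed
  moreover have "(Suc R, c) \<notin> shape tab"
  proof
    assume "(Suc R, c) \<in> shape tab"
    then have "(Suc R, c) \<in> shape tab - {(R, c)}" by simp
    then have "(R, c) \<in> shape tab - {(R, c)}" using d unfolding diagram_def by blast
    then show False by simp
  qed
  ultimately have "c = card (tab R) - 1" "card (tab (Suc R)) < card (tab R)"
    using c by (auto simp: shape_def)
  then show "p \<in> (\<lambda>R. (R, card (tab R) - 1)) ` {R. card (tab (Suc R)) < card (tab R)}"
    using pe by auto
next
  fix p assume "p \<in> (\<lambda>R. (R, card (tab R) - 1)) ` {R. card (tab (Suc R)) < card (tab R)}"
  then obtain R where R: "card (tab (Suc R)) < card (tab R)" "p = (R, card (tab R) - 1)" by auto
  obtain x tab0 where t0: "tableau (X - {x}) tab0"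
      "\<forall>r. card (tab r) = card (tab0 r) + (if r = R then 1 else 0)"
    using tab_insert_surj[OF assms R(1)] by blast
  have "shape tab0 = shape tab - {p}" using shape_decrement[of tab tab0 R] t0(2) R(2) by simp
  moreover have "diagram (shape tab0)"
    using t0(1) row_dom_card by (simp add: diagram_shape_iff tableau_def)
  ultimately show "p \<in> removable (shape tab)"
    using R by (auto simp: removable_def shape_def)
qed

definition extend_row :: "nat \<Rightarrow> (nat \<Rightarrow> nat set) \<Rightarrow> nat \<Rightarrow> nat \<Rightarrow> nat set" where
  "extend_row b tab R = tab(R := insert b (tab R))"

text \<open>The rows at whose end a cell may be added; row 0 qualifies vacuously.\<close>

definition growth_rows :: "(nat \<Rightarrow> nat set) \<Rightarrow> nat set" where
  "growth_rows tab = {R. \<forall>Q. R = Suc Q \<longrightarrow> card (tab R) < card (tab Q)}"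

lemma shape_extend_row:
  assumes "finite (tab R)" "b \<notin> tab R"
  shows "shape (extend_row b tab R) = insert (R, card (tab R)) (shape tab)"
  using assms by (auto simp: shape_def extend_row_def less_Suc_eq split: if_splits)

lemma card_extend_row:
  assumes "finite (tab R)" "b \<notin> tab R"
  shows "card (extend_row b tab R r) = card (tab r) + (if r = R then 1 else 0)"
  using assms by (simp add: extend_row_def)

text \<open>A letter below all others stands at the end of its row. Thresholds above it do not see
  it, and thresholds at or below it compare whole row lengths, where the growth condition
  applies.\<close>

lemma tableau_extend_row:
  assumes t: "tableau X tab" and b: "\<And>v. v \<in> X \<Longrightarrow> b < v" and R: "R \<in> growth_rows tab"
  shows "tableau (insert b X) (extend_row b tab R)"
proof -
  let ?t = "extend_row b tab R"
  have sub: "tab r \<subseteq> X" for r using t by (auto simp: tableau_def)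
  then have bn: "b \<notin> tab r" for r using b by blast
  note fin = tableau_finite[OF t]
  note cr = card_extend_row[OF fin bn]
  have "(\<Union>r. ?t r) = insert b (\<Union>r. tab r)" by (auto simp: extend_row_def split: if_splits)
  then have "(\<Union>r. ?t r) = insert b X" using t by (simp add: tableau_def)
  moreover have "?t r \<inter> ?t s = {}" if "r \<noteq> s" for r s
    using t that bn by (auto simp: extend_row_def tableau_def)
  moreover have "row_dom (?t (Suc r)) (?t r)" for r
    unfolding row_dom_def
  proof
    fix y
    have d: "row_dom (tab (Suc r)) (tab r)" using t by (simp add: tableau_def)
    show "card (?t (Suc r) \<inter> {y..}) \<le> card (?t r \<inter> {y..})"
    proof (cases "y \<le> b")
      case True
      have "?t s \<inter> {y..} = ?t s" for s
        using True sub b by (fastforce simp: extend_row_def split: if_splits)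
      moreover have "card (tab (Suc r)) \<le> card (tab r)" using row_dom_card[OF d] .
      moreover have "card (tab (Suc r)) < card (tab r)" if "R = Suc r"
        using R that by (auto simp: growth_rows_def)
      ultimately show ?thesis by (auto simp: cr)
    next
      case False
      then have "?t s \<inter> {y..} = tab s \<inter> {y..}" for s by (auto simp: extend_row_def)
      then show ?thesis using d by (simp add: row_dom_def)
    qed
  qed
  ultimately show ?thesis using t by (simp add: tableau_def)
qed

text \<open>Converse of \<open>tableau_extend_row\<close>: erasing the minimum \<open>b\<close> can
  be undone only by putting it at the end of a growth row.\<close>

lemma tableau_add_Min_cases:
  assumes t: "tableau X tab" and b: "\<And>v. v \<in> X \<Longrightarrow> b < v"
    and t': "tableau (insert b X) tab'" and res: "\<And>r. tab' r \<inter> {b<..} = tab r"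
  obtains R where "R \<in> growth_rows tab" "tab' = extend_row b tab R"
proof -
  have "b \<in> (\<Union>r. tab' r)" using t' by (simp add: tableau_def)
  then obtain R where R: "b \<in> tab' R" by blast
  have eq: "tab' r = extend_row b tab R r" for r
  proof -
    have sub: "tab' r \<subseteq> insert b X" using t' by (auto simp: tableau_def)
    have "b \<in> tab' r \<longleftrightarrow> r = R" using R t' by (auto simp: tableau_def)
    moreover have "tab' r - {b} = tab r" using sub b res[of r, symmetric] by auto
    ultimately show ?thesis by (auto simp: extend_row_def)
  qed
  have bn: "b \<notin> tab r" for r using res[of r] by auto
  note cr = card_extend_row[OF tableau_finite[OF t] bn]
  have "card (tab (Suc Q)) < card (tab Q)" if "R = Suc Q" for Q
    using tableau_card_antimono[OF t', of Q "Suc Q"] that by (simp add: eq cr)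
  then have "R \<in> growth_rows tab" by (auto simp: growth_rows_def)
  moreover have "tab' = extend_row b tab R" using eq by blast
  ultimately show ?thesis by (rule that)
qed

lemma addable_shape:
  assumes "tableau X tab"
  shows "addable (shape tab) = (\<lambda>R. (R, card (tab R))) ` growth_rows tab"
proof (intro equalityI subsetI)
  fix p assume p: "p \<in> addable (shape tab)"
  obtain R c where pe: "p = (R, c)" by force
  have c: "\<not> c < card (tab R)" and d: "diagram (insert (R, c) (shape tab))"
    using p by (auto simp: addable_def pe shape_def)
  have "c = card (tab R)"
  proof (rule ccontr)
    assume "c \<noteq> card (tab R)"
    then obtain c' where c': "c = Suc c'" "card (tab R) \<le> c'" using c by (cases c) auto
    then have "(R, c') \<in> insert (R, c) (shape tab)" using d unfolding diagram_def by blast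
    then show False using c' by (simp add: shape_def)
  qed
  moreover have "card (tab R) < card (tab Q)" if "R = Suc Q" for Q
  proof -
    have "(Q, c) \<in> insert (R, c) (shape tab)" using d that unfolding diagram_def by blast
    then show ?thesis using that calculation by (simp add: shape_def)
  qed
  ultimately show "p \<in> (\<lambda>R. (R, card (tab R))) ` growth_rows tab"
    using pe by (auto simp: growth_rows_def)
next
  fix p assume "p \<in> (\<lambda>R. (R, card (tab R))) ` growth_rows tab"
  then obtain R where R: "R \<in> growth_rows tab" "p = (R, card (tab R))" by auto
  have mono: "card (tab (Suc r)) \<le> card (tab r)" for r
    using tableau_card_antimono[OF assms] by simp
  have "diagram (insert p (shape tab))"
    unfolding diagram_def
  proof (intro conjI allI impI)
    fix r c assume "(Suc r, c) \<in> insert p (shape tab)"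
    then show "(r, c) \<in> insert p (shape tab)"
      using R mono[of r] by (auto simp: shape_def growth_rows_def)
  next
    fix r c assume "(r, Suc c) \<in> insert p (shape tab)"
    then show "(r, c) \<in> insert p (shape tab)"
      using R by (auto simp: shape_def)
  qed
  then show "p \<in> addable (shape tab)" using R by (simp add: addable_def shape_def)
qed

text \<open>Disjointness makes the nonempty rows distinct subsets of \<open>X\<close>, so there are
  finitely many; a growth row is row 0 or follows a nonempty row.\<close>

lemma finite_corner_rows:
  assumes "tableau X tab"
  shows "finite {R. card (tab (Suc R)) < card (tab R)}" "finite (growth_rows tab)"
proof -
  have "finite {R. tab R \<noteq> {}}"
  proof (rule finite_imageD)
    have "tab ` {R. tab R \<noteq> {}} \<subseteq> Pow X" using assms by (auto simp: tableau_def)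
    then show "finite (tab ` {R. tab R \<noteq> {}})"
      using assms by (auto simp: tableau_def intro: finite_subset)
    have "R = Q" if "tab R \<noteq> {}" "tab R = tab Q" for R Q
    proof (rule ccontr)
      assume "R \<noteq> Q"
      then have "tab R \<inter> tab Q = {}" using assms unfolding tableau_def by blast
      then show False using that by simp
    qed
    then show "inj_on tab {R. tab R \<noteq> {}}" by (simp add: inj_on_def)
  qed
  then have fin: "finite (insert 0 (Suc ` {R. tab R \<noteq> {}}))" "finite {R. tab R \<noteq> {}}" by auto
  have "{R. card (tab (Suc R)) < card (tab R)} \<subseteq> {R. tab R \<noteq> {}}" by auto
  then show "finite {R. card (tab (Suc R)) < card (tab R)}" using fin(2) finite_subset by blast
  have "growth_rows tab \<subseteq> insert 0 (Suc ` {R. tab R \<noteq> {}})"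
  proof
    fix R assume "R \<in> growth_rows tab"
    then show "R \<in> insert 0 (Suc ` {R. tab R \<noteq> {}})"
      by (cases R) (auto simp: growth_rows_def)
  qed
  then show "finite (growth_rows tab)" using fin(1) finite_subset by blast
qed

section \<open>Matchings and oscillating tableaux\<close>

text \<open>\<open>opn\<close> and \<open>cls\<close> put openers and closers on one time axis.
  Strict monotonicity and \<open>opn_neq_cls\<close> allow at most one event per time and make the
  order of letters that of the closing times.\<close>

locale arc_system =
  fixes S T :: "nat set" and opn cls :: "nat \<Rightarrow> nat"
  assumes finite_S: "finite S" and finite_T: "finite T"
    and opn_mono: "strict_mono opn" and cls_mono: "strict_mono cls"
    and opn_neq_cls: "\<And>a b. opn a \<noteq> cls b"
begin

text \<open>Time \<open>t\<close> lies just before the event at \<open>t\<close>: an arc that closes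
  at \<open>t\<close> is still open, one that opens at \<open>t\<close> is not yet.\<close>

definition open_at :: "(nat \<Rightarrow> nat) \<Rightarrow> nat \<Rightarrow> nat set" where
  "open_at g t = {a \<in> S. opn a < t \<and> t \<le> cls (g a)}"

definition word :: "(nat \<Rightarrow> nat) \<Rightarrow> nat \<Rightarrow> nat list" where
  "word g t = read g (open_at g t)"

definition bounded :: "nat \<Rightarrow> nat \<Rightarrow> (nat \<Rightarrow> nat) \<Rightarrow> nat \<Rightarrow> bool" where
  "bounded i j g t \<longleftrightarrow> chain_len (<) (word g t) \<le> i \<and> chain_len (>) (word g t) \<le> j"

text \<open>The matchings seen up to time \<open>t\<close>: \<open>X\<close> stands for the closers, still to come, of the arcs that
  are open at time \<open>t\<close>. Only their relative order matters, so \<open>X\<close> need not consist of elements of \<open>T\<close>.\<close>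

definition partial_matchings :: "nat \<Rightarrow> nat \<Rightarrow> nat \<Rightarrow> nat set \<Rightarrow> (nat \<Rightarrow> nat) set" where
  "partial_matchings i j t X = {g \<in> extensional {a \<in> S. opn a < t}.
     bij_betw g {a \<in> S. opn a < t} ({b \<in> T. cls b < t} \<union> X) \<and>
     (\<forall>a\<in>{a \<in> S. opn a < t}. opn a < cls (g a)) \<and> (\<forall>s\<le>t. bounded i j g s)}"

section \<open>Effect of one time step on partial matchings\<close>

lemma finite_open_at: "finite (open_at g t)"
  using finite_S by (simp add: open_at_def)

lemma finite_partial_matchings:
  assumes "finite X"
  shows "finite (partial_matchings i j t X)"
proof (rule finite_subset)
  show "partial_matchings i j t X \<subseteq> {a \<in> S. opn a < t} \<rightarrow>\<^sub>E ({b \<in> T. cls b < t} \<union> X)"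
    unfolding partial_matchings_def PiE_def by (auto dest: bij_betwE)
  show "finite ({a \<in> S. opn a < t} \<rightarrow>\<^sub>E ({b \<in> T. cls b < t} \<union> X))"
    using finite_S finite_T assms by (intro finite_PiE) auto
qed

lemma word_cong:
  assumes "\<And>a. a \<in> S \<Longrightarrow> opn a < t \<Longrightarrow> g a = h a"
  shows "word g t = word h t"
proof -
  have "open_at g t = open_at h t" using assms by (auto simp: open_at_def)
  moreover have "read g (open_at h t) = read h (open_at h t)"
    using assms finite_open_at[of h t] by (auto simp: open_at_def)
  ultimately show ?thesis by (simp add: word_def)
qed

lemma word_partial_matching:
  assumes "g \<in> partial_matchings i j t X" "\<forall>b\<in>X. t \<le> cls b"
  shows "distinct (word g t)" "set (word g t) = X"
proof -
  have bij: "bij_betw g {a \<in> S. opn a < t} ({b \<in> T. cls b < t} \<union> X)"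
    using assms(1) by (simp add: partial_matchings_def)
  have "inj_on g (open_at g t)"
    by (rule inj_on_subset[OF bij_betw_imp_inj_on[OF bij]]) (auto simp: open_at_def)
  then show "distinct (word g t)"
    unfolding word_def using finite_open_at[of g t] by (simp add: distinct_map)
  have "g ` open_at g t = {b \<in> g ` {a \<in> S. opn a < t}. t \<le> cls b}" by (auto simp: open_at_def)
  also have "\<dots> = X"
    unfolding bij_betw_imp_surj_on[OF bij] using assms(2) by auto
  finally show "set (word g t) = X"
    unfolding word_def using finite_open_at[of g t] by simp
qed

lemma bounded_iff_shape:
  assumes "distinct (word g t)"
  shows "bounded i j g t \<longleftrightarrow> shape (P_tab (word g t)) \<subseteq> {..<i} \<times> {..<j}"
  unfolding bounded_def shape_P_tab_subset_iff[OF assms] ..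

lemma partial_matchings_idle:
  assumes "t \<notin> opn ` S" "t \<notin> cls ` T" "\<forall>b\<in>X. Suc t \<le> cls b"
  shows "partial_matchings i j (Suc t) X = partial_matchings i j t X"
    and "g \<in> partial_matchings i j t X \<Longrightarrow> word g (Suc t) = word g t"
proof -
  have S: "{a \<in> S. opn a < Suc t} = {a \<in> S. opn a < t}" and T: "{b \<in> T. cls b < Suc t} = {b \<in> T. cls b < t}"
    using assms(1,2) by (auto simp: less_Suc_eq)
  have w: "word g (Suc t) = word g t"
    if bij: "bij_betw g {a \<in> S. opn a < t} ({b \<in> T. cls b < t} \<union> X)" for g
  proof -
    have "t \<noteq> cls (g a)" if "a \<in> S" "opn a < t" for a
      using bij_betwE[OF bij] that assms(3) by fastforce
    then have "open_at g (Suc t) = open_at g t"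
      unfolding open_at_def using S by (auto simp: Suc_le_eq le_less)
    then show ?thesis by (simp add: word_def)
  qed
  then show "g \<in> partial_matchings i j t X \<Longrightarrow> word g (Suc t) = word g t"
    by (simp add: partial_matchings_def)
  show "partial_matchings i j (Suc t) X = partial_matchings i j t X"
    unfolding partial_matchings_def S T
    using w S by (auto simp: bounded_def le_Suc_eq)
qed

text \<open>Closing changes no arc: \<open>b0\<close> only passes from the pending closers to the
  used ones. It is the smallest letter of the word, and the bound at the new time comes for free
  because erasing letters shrinks the shape.\<close>

lemma partial_matchings_close:
  assumes b0: "b0 \<in> T" "t = cls b0" and later: "\<forall>b\<in>X. Suc t \<le> cls b"
  shows "partial_matchings i j (Suc t) X = partial_matchings i j t (insert b0 X)"
    and "g \<in> partial_matchings i j t (insert b0 X) \<Longrightarrow> word g (Suc t) = filter (\<lambda>v. b0 < v) (word g t)"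
proof -
  have X: "Suc t \<le> cls b" if "b \<in> X" for b using later that by blast
  have cls_iff: "cls a < cls b \<longleftrightarrow> a < b" "cls a = cls b \<longleftrightarrow> a = b" "cls a \<le> cls b \<longleftrightarrow> a \<le> b" for a b
    using cls_mono by (auto simp: strict_mono_less strict_mono_eq strict_mono_less_eq)
  have S: "{a \<in> S. opn a < Suc t} = {a \<in> S. opn a < t}"
    using opn_neq_cls b0 by (auto simp: less_Suc_eq)
  have T: "{b \<in> T. cls b < Suc t} \<union> X = {b \<in> T. cls b < t} \<union> insert b0 X"
    using b0 by (auto simp: less_Suc_eq cls_iff)
  have X': "\<forall>b\<in>insert b0 X. t \<le> cls b" using b0 X Suc_leD by blast
  have w: "word g (Suc t) = filter (\<lambda>v. b0 < v) (word g t)" for g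
  proof -
    have "open_at g (Suc t) = {a \<in> open_at g t. b0 < g a}"
      unfolding open_at_def b0(2) using S[unfolded b0(2)] by (auto simp: Suc_le_eq cls_iff less_imp_le)
    then show ?thesis unfolding word_def by (simp add: filter_read[OF finite_open_at])
  qed
  then show "g \<in> partial_matchings i j t (insert b0 X) \<Longrightarrow> word g (Suc t) = filter (\<lambda>v. b0 < v) (word g t)" .
  have bd: "bounded i j g (Suc t)" if "distinct (word g t)" "bounded i j g t" for g
  proof -
    have "card (P_tab (word g t) r \<inter> {b0<..}) \<le> card (P_tab (word g t) r)" for r
      using tableau_finite[OF tableau_P_tab[OF that(1)]] by (intro card_mono) auto
    then have "shape (P_tab (word g (Suc t))) \<subseteq> shape (P_tab (word g t))"
      unfolding shape_def w P_tab_filter by (auto intro: less_le_trans)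
    moreover have "distinct (word g (Suc t))" unfolding w using that(1) by simp
    ultimately show ?thesis
      using that bounded_iff_shape by blast
  qed
  show "partial_matchings i j (Suc t) X = partial_matchings i j t (insert b0 X)"
  proof (intro equalityI subsetI)
    fix g assume "g \<in> partial_matchings i j (Suc t) X"
    then show "g \<in> partial_matchings i j t (insert b0 X)"
      unfolding partial_matchings_def S T by auto
  next
    fix g assume g: "g \<in> partial_matchings i j t (insert b0 X)"
    then have "bounded i j g (Suc t)"
      using bd word_partial_matching(1)[OF g X'] by (simp add: partial_matchings_def)
    then show "g \<in> partial_matchings i j (Suc t) X"
      using g unfolding partial_matchings_def S T by (auto simp: le_Suc_eq)
  qed
qed

text \<open>The arc opened at \<open>t\<close> must take a pending closer, since the used ones lie
  in the past. The third fact records the default value of extensional functions, which makes the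
  update at \<open>a0\<close> reversible.\<close>

lemma partial_matchings_open:
  assumes a0: "a0 \<in> S" "t = opn a0" and later: "\<forall>b\<in>X. Suc t \<le> cls b"
  shows "g \<in> partial_matchings i j (Suc t) X \<longleftrightarrow>
      (\<exists>x\<in>X. \<exists>g0\<in>partial_matchings i j t (X - {x}). g = g0(a0 := x) \<and> bounded i j g (Suc t))"
    and "x \<in> X \<Longrightarrow> g0 \<in> partial_matchings i j t (X - {x}) \<Longrightarrow> word (g0(a0 := x)) (Suc t) = x # word g0 t"
    and "g0 \<in> partial_matchings i j t Y \<Longrightarrow> g0 a0 = undefined"
proof -
  have X: "Suc t \<le> cls b" if "b \<in> X" for b using later that by blast
  have opn_iff: "opn a < opn b \<longleftrightarrow> a < b" "opn a = opn b \<longleftrightarrow> a = b" for a b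
    using opn_mono by (auto simp: strict_mono_less strict_mono_eq)
  define St where "St = {a \<in> S. opn a < t}"
  have S: "{a \<in> S. opn a < Suc t} = insert a0 St"
    using a0 by (auto simp: less_Suc_eq opn_iff St_def)
  have a0n: "a0 \<notin> St" using a0 by (simp add: St_def)
  have T: "{b \<in> T. cls b < Suc t} = {b \<in> T. cls b < t}"
    using opn_neq_cls[of a0, symmetric] a0 by (auto simp: less_Suc_eq)
  define Tt where "Tt = {b \<in> T. cls b < t}"
  have TX: "b \<notin> Tt" if "b \<in> X" for b using X[OF that] by (simp add: Tt_def)
  show und: "g0 a0 = undefined" if "g0 \<in> partial_matchings i j t Y" for g0 Y
    using that a0n by (auto simp: partial_matchings_def extensional_def St_def)
  have upd: "word (g0(a0 := x)) s = word g0 s" if "s \<le> t" for g0 x s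
    using that a0 by (intro word_cong) auto
  show w: "word (g0(a0 := x)) (Suc t) = x # word g0 t"
    if x: "x \<in> X" and g0: "g0 \<in> partial_matchings i j t (X - {x})" for x g0
  proof -
    have ne: "cls b \<noteq> t" for b using opn_neq_cls[of a0 b] a0 by simp
    have "open_at (g0(a0 := x)) (Suc t) = insert a0 (open_at g0 t)"
    proof -
      have "a \<in> open_at (g0(a0 := x)) (Suc t) \<longleftrightarrow> a \<in> insert a0 (open_at g0 t)" for a
      proof (cases "a = a0")
        case True
        then show ?thesis using a0 X[OF x] by (simp add: open_at_def)
      next
        case False
        then have "opn a \<noteq> t" using a0 by (simp add: opn_iff)
        then show ?thesis using False ne[of "g0 a"] by (auto simp: open_at_def less_Suc_eq Suc_le_eq)
      qed
      then show ?thesis by blast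
    qed
    \<comment> \<open>\<open>a0\<close> is the latest opener, so its letter becomes the head of the
      word.\<close>
    moreover have "a < a0" if "a \<in> open_at g0 t" for a
      using that a0 by (simp add: open_at_def opn_iff)
    then have "sorted_list_of_set (insert a0 (open_at g0 t)) = sorted_list_of_set (open_at g0 t) @ [a0]"
      by (rule sorted_list_of_set_insert_max[OF finite_open_at])
    moreover have "a0 \<notin> open_at g0 t" using a0 by (simp add: open_at_def)
    ultimately show ?thesis
      unfolding word_def using finite_open_at[of g0 t] by (auto simp del: sorted_list_of_set_insert_remove)
  qed
  show "g \<in> partial_matchings i j (Suc t) X \<longleftrightarrow>
      (\<exists>x\<in>X. \<exists>g0\<in>partial_matchings i j t (X - {x}). g = g0(a0 := x) \<and> bounded i j g (Suc t))"
  proof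
    assume g: "g \<in> partial_matchings i j (Suc t) X"
    then have ext: "g \<in> extensional (insert a0 St)" and bij: "bij_betw g (insert a0 St) (Tt \<union> X)"
      and lt: "\<And>a. a \<in> insert a0 St \<Longrightarrow> opn a < cls (g a)" and bd: "\<And>s. s \<le> Suc t \<Longrightarrow> bounded i j g s"
      unfolding partial_matchings_def S T by (auto simp: Tt_def)
    have x: "g a0 \<in> X"
    proof -
      have "g a0 \<in> Tt \<union> X" using bij_betwE[OF bij] by simp
      moreover have "g a0 \<notin> Tt" using lt[of a0] a0(2) by (simp add: Tt_def)
      ultimately show ?thesis by simp
    qed
    define g0 where "g0 = restrict g St"
    have eq: "g = g0(a0 := g a0)"
    proof
      fix a show "g a = (g0(a0 := g a0)) a"
        using ext by (auto simp: g0_def restrict_def extensional_def)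
    qed
    have "bij_betw g St ((Tt \<union> X) - {g a0})"
    proof -
      have "(Tt \<union> X) - {g a0} \<union> {g a0} = Tt \<union> X" using x by auto
      then show ?thesis
        using notIn_Un_bij_betw3[of a0 St g "(Tt \<union> X) - {g a0}"] a0n bij by simp
    qed
    moreover have "(Tt \<union> X) - {g a0} = Tt \<union> (X - {g a0})" using TX[OF x] by auto
    ultimately have "bij_betw g0 St (Tt \<union> (X - {g a0}))"
      by (subst bij_betw_cong[of _ _ g]) (auto simp: g0_def)
    moreover have "bounded i j g0 s" if "s \<le> t" for s
      using bd[of s] upd[OF that, of g0 "g a0"] that eq by (simp add: bounded_def)
    moreover have "g0 \<in> extensional St" by (simp add: g0_def)
    moreover have "opn a < cls (g0 a)" if "a \<in> S" "opn a < t" for a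
      using lt[of a] that by (simp add: g0_def St_def)
    ultimately have "g0 \<in> partial_matchings i j t (X - {g a0})"
      unfolding partial_matchings_def by (simp add: St_def Tt_def)
    then show "\<exists>x\<in>X. \<exists>g0\<in>partial_matchings i j t (X - {x}). g = g0(a0 := x) \<and> bounded i j g (Suc t)"
      using x eq bd[of "Suc t"] by blast
  next
    assume "\<exists>x\<in>X. \<exists>g0\<in>partial_matchings i j t (X - {x}). g = g0(a0 := x) \<and> bounded i j g (Suc t)"
    then obtain x g0 where x: "x \<in> X" and g0: "g0 \<in> partial_matchings i j t (X - {x})"
      and g: "g = g0(a0 := x)" and bd: "bounded i j g (Suc t)" by blast
    have g0': "g0 \<in> extensional St" "bij_betw g0 St (Tt \<union> (X - {x}))"
      "\<And>a. a \<in> St \<Longrightarrow> opn a < cls (g0 a)" "\<And>s. s \<le> t \<Longrightarrow> bounded i j g0 s"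
      using g0 unfolding partial_matchings_def by (auto simp: St_def Tt_def)
    have "bij_betw g St (Tt \<union> (X - {x}))"
      using g0'(2) a0n by (subst bij_betw_cong[of _ _ g0]) (auto simp: g)
    moreover have "g a0 = x" "x \<notin> Tt \<union> (X - {x})" using TX[OF x] by (auto simp: g)
    ultimately have "bij_betw g (insert a0 St) (insert x (Tt \<union> (X - {x})))"
      using a0n notIn_Un_bij_betw3[of a0 St g "Tt \<union> (X - {x})"] by simp
    moreover have "insert x (Tt \<union> (X - {x})) = Tt \<union> X" using x by auto
    ultimately have "bij_betw g (insert a0 St) (Tt \<union> X)" by simp
    moreover have "g \<in> extensional (insert a0 St)"
      using g0'(1) by (auto simp: g extensional_def)
    moreover have "opn a < cls (g a)" if "a \<in> insert a0 St" for a
      using that g0'(3)[of a] X[OF x] a0 by (auto simp: g)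
    moreover have "bounded i j g s" if "s \<le> Suc t" for s
    proof (cases "s = Suc t")
      case False
      then show ?thesis using that g0'(4)[of s] upd[of s g0 x] by (simp add: bounded_def g)
    qed (use bd in simp)
    ultimately show "g \<in> partial_matchings i j (Suc t) X"
      unfolding partial_matchings_def S T by (simp add: Tt_def)
  qed
qed

section \<open>Counting matchings with a prescribed tableau\<close>

definition with_tab :: "nat \<Rightarrow> nat \<Rightarrow> nat \<Rightarrow> nat set \<Rightarrow> (nat \<Rightarrow> nat set) \<Rightarrow> (nat \<Rightarrow> nat) set" where
  "with_tab i j t X tab = {g \<in> partial_matchings i j t X. P_tab (word g t) = tab}"

lemma finite_with_tab: "finite X \<Longrightarrow> finite (with_tab i j t X tab)"
  using finite_partial_matchings by (simp add: with_tab_def)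

text \<open>\<open>F\<close> is the count one step earlier as a function of the shape. Each corner
  row \<open>R\<close> of \<open>tab\<close> determines one letter \<open>xR R\<close> and one
  earlier tableau \<open>tR R\<close>, and the matchings split according to
  \<open>R\<close>.\<close>

lemma card_with_tab_open:
  assumes a0: "a0 \<in> S" "t = opn a0" and X: "\<forall>b\<in>X. Suc t \<le> cls b"
    and tab: "tableau X tab" and box: "shape tab \<subseteq> {..<i} \<times> {..<j}"
    and IH: "\<And>x tab0. x \<in> X \<Longrightarrow> tableau (X - {x}) tab0 \<Longrightarrow> card (with_tab i j t (X - {x}) tab0) = F (shape tab0)"
  shows "card (with_tab i j (Suc t) X tab) = (\<Sum>p\<in>removable (shape tab). F (shape tab - {p}))"
proof -
  define Rs where "Rs = {R. card (tab (Suc R)) < card (tab R)}"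
  have "\<forall>R\<in>Rs. \<exists>p. fst p \<in> X \<and> tableau (X - {fst p}) (snd p) \<and> tab_insert (fst p) (snd p) = tab \<and>
      (\<forall>r. card (tab r) = card (snd p r) + (if r = R then 1 else 0))"
    using tab_insert_surj[OF tab] unfolding Rs_def by fastforce
  then obtain h where h: "\<And>R. R \<in> Rs \<Longrightarrow> fst (h R) \<in> X \<and> tableau (X - {fst (h R)}) (snd (h R)) \<and>
      tab_insert (fst (h R)) (snd (h R)) = tab \<and>
      (\<forall>r. card (tab r) = card (snd (h R) r) + (if r = R then 1 else 0))"
    by metis
  define xR where "xR R = fst (h R)" for R
  define tR where "tR R = snd (h R)" for R
  have hX: "xR R \<in> X" and ht: "tableau (X - {xR R}) (tR R)" and hi: "tab_insert (xR R) (tR R) = tab"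
    and hc: "card (tab r) = card (tR R r) + (if r = R then 1 else 0)" if "R \<in> Rs" for R r
    using h[OF that] by (simp_all add: xR_def tR_def)
  have X0: "\<forall>b\<in>X - {x}. t \<le> cls b" for x using X Suc_leD by blast
  note opn1 = partial_matchings_open(1)[OF a0 X]
  note opn2 = partial_matchings_open(2)[OF a0 X]
  note opn3 = partial_matchings_open(3)[OF a0 X]
  define W where "W R = with_tab i j t (X - {xR R}) (tR R)" for R
  define up where "up R = (\<lambda>g0. g0(a0 := xR R))" for R
  have finX: "finite X" using tab by (simp add: tableau_def)
  have und: "g0 a0 = undefined" if "g0 \<in> W R" for g0 R
    using that opn3[of g0 i j] unfolding W_def with_tab_def by blast
  have eq: "with_tab i j (Suc t) X tab = (\<Union>R\<in>Rs. up R ` W R)"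
  proof (intro equalityI subsetI)
    fix g assume "g \<in> with_tab i j (Suc t) X tab"
    then have g: "g \<in> partial_matchings i j (Suc t) X" "P_tab (word g (Suc t)) = tab"
      by (auto simp: with_tab_def)
    obtain x g0 where x: "x \<in> X" and g0: "g0 \<in> partial_matchings i j t (X - {x})" and gg: "g = g0(a0 := x)"
      using g(1) unfolding opn1 by blast
    have dw: "distinct (word g0 t)" "set (word g0 t) = X - {x}"
      using word_partial_matching[OF g0 X0] by auto
    have t0: "tableau (X - {x}) (P_tab (word g0 t))"
      using tableau_P_tab[OF dw(1)] dw(2) by simp
    have ins: "tab_insert x (P_tab (word g0 t)) = tab"
      using g(2) opn2[OF x g0] by (simp add: gg P_tab_Cons)
    obtain R where R: "\<forall>r. card (tab r) = card (P_tab (word g0 t) r) + (if r = R then 1 else 0)"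
      using card_tab_insert[OF t0, of x] unfolding ins by auto
    have "R \<in> Rs"
      using R[rule_format, of R] R[rule_format, of "Suc R"] tableau_card_antimono[OF t0, of R "Suc R"]
      by (simp add: Rs_def)
    have "x = xR R \<and> P_tab (word g0 t) = tR R"
    proof (rule tab_insert_inject[OF t0 _ ht[OF \<open>R \<in> Rs\<close>]])
      show "tab_insert x (P_tab (word g0 t)) = tab_insert (xR R) (tR R)"
        using ins hi[OF \<open>R \<in> Rs\<close>] by simp
      show "card (tab_insert x (P_tab (word g0 t)) r) = card (P_tab (word g0 t) r) + (if r = R then 1 else 0)" for r
        using R unfolding ins by simp
      show "card (tab_insert (xR R) (tR R) r) = card (tR R r) + (if r = R then 1 else 0)" for r
        unfolding hi[OF \<open>R \<in> Rs\<close>] by (rule hc[OF \<open>R \<in> Rs\<close>])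
    qed auto
    then have "g0 \<in> W R" "g = up R g0"
      using g0 gg by (auto simp: W_def with_tab_def up_def)
    then show "g \<in> (\<Union>R\<in>Rs. up R ` W R)" using \<open>R \<in> Rs\<close> by blast
  next
    fix g assume "g \<in> (\<Union>R\<in>Rs. up R ` W R)"
    then obtain R g0 where R: "R \<in> Rs" and "g0 \<in> W R" and gg: "g = g0(a0 := xR R)"
      by (auto simp: up_def)
    then have g0: "g0 \<in> partial_matchings i j t (X - {xR R})" "P_tab (word g0 t) = tR R"
      by (auto simp: W_def with_tab_def)
    have dw: "distinct (word g0 t)" "set (word g0 t) = X - {xR R}"
      using word_partial_matching[OF g0(1) X0] by auto
    have w: "word g (Suc t) = xR R # word g0 t"
      unfolding gg by (rule opn2[OF hX[OF R] g0(1)])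
    have P: "P_tab (word g (Suc t)) = tab"
      unfolding w P_tab_Cons g0(2) by (rule hi[OF R])
    have "distinct (word g (Suc t))" unfolding w using dw by simp
    then have "bounded i j g (Suc t)" using box by (simp add: bounded_iff_shape P)
    then have "g \<in> partial_matchings i j (Suc t) X"
      unfolding opn1 using hX[OF R] g0(1) gg by blast
    then show "g \<in> with_tab i j (Suc t) X tab" using P by (simp add: with_tab_def)
  qed
  have inj: "g0 = g0' \<and> R = R'"
    if "R \<in> Rs" "R' \<in> Rs" "g0 \<in> W R" "g0' \<in> W R'" "up R g0 = up R' g0'" for R R' g0 g0'
  proof -
    have "g0 a = g0' a" for a
      using fun_cong[OF that(5), of a] und[OF that(3)] und[OF that(4)]
      by (cases "a = a0") (auto simp: up_def)
    then have g: "g0 = g0'" by blast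
    then have "tR R = tR R'" using that by (auto simp: W_def with_tab_def)
    \<comment> \<open>\<open>tR R\<close> is shorter than \<open>tab\<close> in row \<open>R\<close>
      only, so it determines \<open>R\<close>.\<close>
    then have "R = R'" using hc[OF that(1), of R] hc[OF that(2), of R] by (auto split: if_splits)
    then show ?thesis using g by simp
  qed
  have "card (with_tab i j (Suc t) X tab) = (\<Sum>R\<in>Rs. card (up R ` W R))"
    unfolding eq
  proof (rule card_UN_disjoint)
    show "finite Rs" using finite_corner_rows(1)[OF tab] by (simp add: Rs_def)
    show "\<forall>R\<in>Rs. finite (up R ` W R)" using finite_with_tab finX by (simp add: W_def)
    show "\<forall>R\<in>Rs. \<forall>R'\<in>Rs. R \<noteq> R' \<longrightarrow> up R ` W R \<inter> up R' ` W R' = {}"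
      using inj by blast
  qed
  also have "\<dots> = (\<Sum>R\<in>Rs. F (shape tab - {(R, card (tab R) - 1)}))"
  proof (rule sum.cong[OF refl])
    fix R assume R: "R \<in> Rs"
    have "inj_on (up R) (W R)" using inj[OF R R] by (simp add: inj_on_def)
    then have "card (up R ` W R) = F (shape (tR R))"
      using IH[OF hX[OF R] ht[OF R]] by (simp add: card_image W_def)
    then show "card (up R ` W R) = F (shape tab - {(R, card (tab R) - 1)})"
      using shape_decrement[of tab "tR R" R] hc[OF R] by simp
  qed
  also have "\<dots> = (\<Sum>p\<in>removable (shape tab). F (shape tab - {p}))"
    unfolding removable_shape[OF tab] Rs_def by (subst sum.reindex) (auto simp: inj_on_def)
  finally show ?thesis .
qed

text \<open>Seen backwards, closing adds a smallest letter \<open>b0\<close> at the end of any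
  growth row, and the matchings split according to the row of \<open>b0\<close>.\<close>

lemma card_with_tab_close:
  assumes b0: "b0 \<in> T" "t = cls b0" and X: "\<forall>b\<in>X. Suc t \<le> cls b"
    and tab: "tableau X tab"
    and IH: "\<And>tab'. tableau (insert b0 X) tab' \<Longrightarrow> card (with_tab i j t (insert b0 X) tab') = F (shape tab')"
  shows "card (with_tab i j (Suc t) X tab) = (\<Sum>p\<in>addable (shape tab). F (insert p (shape tab)))"
proof -
  have lt: "b0 < v" if "v \<in> X" for v
    using bspec[OF X that] b0 cls_mono by (simp add: Suc_le_eq strict_mono_less)
  have X0: "\<forall>b\<in>insert b0 X. t \<le> cls b" using X b0(2) Suc_leD by blast
  have sub: "tab r \<subseteq> X" for r using tab by (auto simp: tableau_def)
  have bn: "b0 \<notin> tab r" for r using sub[of r] lt by blast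
  note close = partial_matchings_close[OF b0 X]
  define W where "W R = with_tab i j t (insert b0 X) (extend_row b0 tab R)" for R
  have finX: "finite X" using tab by (simp add: tableau_def)
  have res: "extend_row b0 tab R r \<inter> {b0<..} = tab r" for R r
    using sub[of r] lt by (auto simp: extend_row_def)
  have eq: "with_tab i j (Suc t) X tab = (\<Union>R\<in>growth_rows tab. W R)"
  proof (intro equalityI subsetI)
    fix g assume "g \<in> with_tab i j (Suc t) X tab"
    then have g: "g \<in> partial_matchings i j t (insert b0 X)" "P_tab (word g (Suc t)) = tab"
      by (auto simp: with_tab_def close(1))
    have "tableau (insert b0 X) (P_tab (word g t))"
      using tableau_P_tab[of "word g t"] word_partial_matching[OF g(1) X0] by simp
    moreover have "P_tab (word g t) r \<inter> {b0<..} = tab r" for r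
      using g(2) close(2)[OF g(1)] by (simp add: P_tab_filter[symmetric])
    ultimately obtain R where "R \<in> growth_rows tab" "P_tab (word g t) = extend_row b0 tab R"
      using tableau_add_Min_cases[OF tab lt] by blast
    then show "g \<in> (\<Union>R\<in>growth_rows tab. W R)" using g(1) by (auto simp: W_def with_tab_def)
  next
    fix g assume "g \<in> (\<Union>R\<in>growth_rows tab. W R)"
    then obtain R where g: "g \<in> partial_matchings i j t (insert b0 X)" "P_tab (word g t) = extend_row b0 tab R"
      by (auto simp: W_def with_tab_def)
    have "P_tab (word g (Suc t)) r = tab r" for r
      unfolding close(2)[OF g(1)] P_tab_filter g(2) by (rule res)
    then show "g \<in> with_tab i j (Suc t) X tab" using g(1) by (auto simp: with_tab_def close(1))
  qed
  have "card (with_tab i j (Suc t) X tab) = (\<Sum>R\<in>growth_rows tab. card (W R))"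
    unfolding eq
  proof (rule card_UN_disjoint)
    show "finite (growth_rows tab)" by (rule finite_corner_rows(2)[OF tab])
    show "\<forall>R\<in>growth_rows tab. finite (W R)" using finite_with_tab finX by (simp add: W_def)
    have "R = R'" if "extend_row b0 tab R = extend_row b0 tab R'" for R R'
      using fun_cong[OF that, of R] bn[of R] by (auto simp: extend_row_def split: if_splits)
    then show "\<forall>R\<in>growth_rows tab. \<forall>R'\<in>growth_rows tab. R \<noteq> R' \<longrightarrow> W R \<inter> W R' = {}"
      by (auto simp: W_def with_tab_def)
  qed
  also have "\<dots> = (\<Sum>R\<in>growth_rows tab. F (insert (R, card (tab R)) (shape tab)))"
  proof (rule sum.cong[OF refl])
    fix R assume "R \<in> growth_rows tab"
    then show "card (W R) = F (insert (R, card (tab R)) (shape tab))"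
      using IH[OF tableau_extend_row[OF tab lt]] shape_extend_row[OF tableau_finite[OF tab] bn]
      by (simp add: W_def)
  qed
  also have "\<dots> = (\<Sum>p\<in>addable (shape tab). F (insert p (shape tab)))"
    unfolding addable_shape[OF tab] by (subst sum.reindex) (auto simp: inj_on_def)
  finally show ?thesis .
qed

text \<open>The key invariance: neither the entries of \<open>tab\<close> nor the content
  \<open>X\<close> matter beyond the shape. Both vary in the induction because undoing an event
  changes them.\<close>

lemma card_with_tab:
  assumes "tableau X tab" "\<forall>b\<in>X. t \<le> cls b"
  shows "card (with_tab i j t X tab) = oscillating i j (opn ` S) (cls ` T) t (shape tab)"
  using assms
proof (induction t arbitrary: X tab)
  case 0
  have word0: "word g 0 = []" for g by (simp add: word_def open_at_def)
  have P0: "P_tab [] = (\<lambda>r. {})"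
  proof
    have "(bumped ^^ r) [] = []" for r by (induction r) auto
    then show "P_tab [] r = {}" for r by (simp add: P_tab_def)
  qed
  have bd: "bounded i j g 0" for g by (simp add: bounded_def word0)
  show ?case
  proof (cases "X = {}")
    case True
    then have "tab r = {}" for r using 0(1) by (auto simp: tableau_def)
    then have tb: "tab = (\<lambda>r. {})" by blast
    \<comment> \<open>Before any event the only matching is the empty one, as an extensional
      function.\<close>
    have "with_tab i j 0 X tab = {\<lambda>_. undefined}"
      unfolding with_tab_def partial_matchings_def word0 P0 tb
      using True bd by (auto simp: bij_betw_def)
    then show ?thesis by (simp add: tb shape_def)
  next
    case False
    then obtain r where "tab r \<noteq> {}" using 0(1) by (auto simp: tableau_def)
    then have "(r, 0) \<in> shape tab"
      using tableau_finite[OF 0(1), of r] by (simp add: shape_def card_gt_0_iff)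
    then have "shape tab \<noteq> {}" by blast
    moreover have "with_tab i j 0 X tab = {}"
      unfolding with_tab_def partial_matchings_def using False by (auto simp: bij_betw_def)
    ultimately show ?thesis by simp
  qed
next
  case (Suc t)
  have le: "\<forall>b\<in>X. t \<le> cls b" using Suc.prems(2) Suc_leD by blast
  consider a0 where "a0 \<in> S" "t = opn a0" | b0 where "b0 \<in> T" "t = cls b0" "t \<notin> opn ` S"
    | "t \<notin> opn ` S" "t \<notin> cls ` T" by blast
  then show ?case
  proof cases
    case 1
    then have tU: "t \<in> opn ` S" by blast
    show ?thesis
    proof (cases "shape tab \<subseteq> {..<i} \<times> {..<j}")
      case True
      have "card (with_tab i j (Suc t) X tab) =
          (\<Sum>p\<in>removable (shape tab). oscillating i j (opn ` S) (cls ` T) t (shape tab - {p}))"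
      proof (rule card_with_tab_open[OF 1 Suc.prems(2) Suc.prems(1) True])
        fix x tab0 assume "x \<in> X" "tableau (X - {x}) tab0"
        then show "card (with_tab i j t (X - {x}) tab0) =
            oscillating i j (opn ` S) (cls ` T) t (shape tab0)"
          using le by (intro Suc.IH) auto
      qed
      then show ?thesis using True tU by simp
    next
      case False
      \<comment> \<open>A shape outside the box violates the bound at \<open>Suc t\<close>, in
        agreement with the value 0 in \<open>oscillating\<close>.\<close>
      have "with_tab i j (Suc t) X tab = {}"
      proof (rule ccontr)
        assume "with_tab i j (Suc t) X tab \<noteq> {}"
        then obtain g where g: "g \<in> partial_matchings i j (Suc t) X" "P_tab (word g (Suc t)) = tab"
          by (auto simp: with_tab_def)
        have "bounded i j g (Suc t)" using g(1) by (simp add: partial_matchings_def)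
        then show False
          using bounded_iff_shape[OF word_partial_matching(1)[OF g(1) Suc.prems(2)]] g(2) False by simp
      qed
      then show ?thesis using False tU by simp
    qed
  next
    case 2
    have "card (with_tab i j (Suc t) X tab) =
        (\<Sum>p\<in>addable (shape tab). oscillating i j (opn ` S) (cls ` T) t (insert p (shape tab)))"
    proof (rule card_with_tab_close[OF 2(1,2) Suc.prems(2) Suc.prems(1)])
      fix tab' assume "tableau (insert b0 X) tab'"
      then show "card (with_tab i j t (insert b0 X) tab') =
          oscillating i j (opn ` S) (cls ` T) t (shape tab')"
        using le 2(2) by (intro Suc.IH) auto
    qed
    then show ?thesis using 2 by simp
  next
    case 3
    have "with_tab i j (Suc t) X tab = with_tab i j t X tab"
      unfolding with_tab_def partial_matchings_idle(1)[OF 3 Suc.prems(2)]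
      using partial_matchings_idle(2)[OF 3 Suc.prems(2)] by auto
    then show ?thesis using 3 Suc.IH[OF Suc.prems(1) le] by simp
  qed
qed

text \<open>The condition on openers and closers ranges over all pairs: the last opener precedes the
  first closer, so the arcs of \<open>A\<close> are open at a common time.\<close>

definition chains_bounded :: "(nat \<Rightarrow> nat \<Rightarrow> bool) \<Rightarrow> nat \<Rightarrow> (nat \<Rightarrow> nat) \<Rightarrow> bool" where
  "chains_bounded R k g \<longleftrightarrow>
     (\<forall>A\<subseteq>S. is_chain R g A \<and> (\<forall>a\<in>A. \<forall>b\<in>A. opn b < cls (g a)) \<longrightarrow> card A \<le> k)"

definition matchings :: "nat \<Rightarrow> nat \<Rightarrow> (nat \<Rightarrow> nat) set" where
  "matchings i j = {g \<in> extensional S. bij_betw g S T \<and> (\<forall>a\<in>S. opn a < cls (g a)) \<and>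
     chains_bounded (<) i g \<and> chains_bounded (>) j g}"

lemma chains_bounded_iff_word:
  assumes "transp R" "\<And>a. a \<in> S \<Longrightarrow> opn a < N"
  shows "chains_bounded R k g \<longleftrightarrow> (\<forall>s\<le>N. chain_len R (word g s) \<le> k)"
proof -
  have "(\<forall>s\<le>N. chain_len R (word g s) \<le> k) \<longleftrightarrow>
      (\<forall>s\<le>N. \<forall>A\<subseteq>open_at g s. is_chain R g A \<longrightarrow> card A \<le> k)"
    unfolding word_def chain_len_le_iff[OF assms(1) finite_open_at] ..
  also have "\<dots> \<longleftrightarrow> chains_bounded R k g"
  proof
    assume L: "\<forall>s\<le>N. \<forall>A\<subseteq>open_at g s. is_chain R g A \<longrightarrow> card A \<le> k"
    show "chains_bounded R k g"
      unfolding chains_bounded_def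
    proof (intro allI impI, elim conjE)
      fix A assume A: "A \<subseteq> S" "is_chain R g A" "\<forall>a\<in>A. \<forall>b\<in>A. opn b < cls (g a)"
      show "card A \<le> k"
      proof (cases "A = {}")
        case False
        have fin: "finite A" using A(1) finite_S finite_subset by blast
        have m: "Max A \<in> A" using fin False by (rule Max_in)
        have "opn a \<le> opn (Max A)" if "a \<in> A" for a
          using opn_mono fin that by (simp add: strict_mono_less_eq)
        \<comment> \<open>All arcs of \<open>A\<close> are open just after the last of them has been
          opened.\<close>
        then have "A \<subseteq> open_at g (Suc (opn (Max A)))"
          using A(1,3) m by (auto simp: open_at_def less_Suc_eq_le Suc_le_eq)
        moreover have "Suc (opn (Max A)) \<le> N"
          using assms(2)[of "Max A"] m A(1) by auto
        ultimately show ?thesis using L A(2) by blast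
      qed simp
    qed
  next
    assume L: "chains_bounded R k g"
    show "\<forall>s\<le>N. \<forall>A\<subseteq>open_at g s. is_chain R g A \<longrightarrow> card A \<le> k"
    proof (intro allI impI)
      fix s A assume A: "A \<subseteq> open_at g s" "is_chain R g A"
      have "A \<subseteq> S" using A(1) by (auto simp: open_at_def)
      moreover have "opn b < cls (g a)" if "a \<in> A" "b \<in> A" for a b
      proof -
        have "opn b < s" "s \<le> cls (g a)" using A(1) that by (auto simp: open_at_def)
        then show ?thesis by (rule less_le_trans)
      qed
      ultimately show "card A \<le> k" using L A(2) unfolding chains_bounded_def by blast
    qed
  qed
  finally show ?thesis ..
qed

lemma card_matchings_swap: "card (matchings i j) = card (matchings j i)"
proof -
  \<comment> \<open>A time after all events: the word is empty there, so the diagrams at both ends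
    of the sequence are empty, and the empty diagram is its own transpose.\<close>
  define N where "N = Suc (Max (insert 0 (opn ` S \<union> cls ` T)))"
  have fin: "finite (insert 0 (opn ` S \<union> cls ` T))" using finite_S finite_T by simp
  have NS: "opn a < N" if "a \<in> S" for a
    using Max_ge[OF fin, of "opn a"] that by (simp add: N_def less_Suc_eq_le)
  have NT: "cls b < N" if "b \<in> T" for b
    using Max_ge[OF fin, of "cls b"] that by (simp add: N_def less_Suc_eq_le)
  have S: "{a \<in> S. opn a < N} = S" and T: "{b \<in> T. cls b < N} = T" using NS NT by auto
  have m: "matchings i j = partial_matchings i j N {}" for i j
    unfolding matchings_def partial_matchings_def S T bounded_def
    using chains_bounded_iff_word[of "(<)" N] chains_bounded_iff_word[of "(>)" N] NS
    by (auto simp: transp_def)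
  have "card (matchings i j) = oscillating i j (opn ` S) (cls ` T) N {}" for i j
  proof -
    have "P_tab (word g N) = (\<lambda>r. {})" if "g \<in> partial_matchings i j N {}" for g
    proof -
      have "set (word g N) = {}" using word_partial_matching(2)[OF that] by simp
      then have "tableau {} (P_tab (word g N))" using tableau_P_tab[of "word g N"] by simp
      then show ?thesis by (auto simp: tableau_def)
    qed
    then have "with_tab i j N {} (\<lambda>r. {}) = matchings i j" by (auto simp: with_tab_def m)
    moreover have "tableau {} (\<lambda>r. {})" by (simp add: tableau_def row_dom_def)
    ultimately show ?thesis using card_with_tab[of "{}" "\<lambda>r. {}" N i j] by (simp add: shape_def)
  qed
  then show ?thesis using oscillating_swap[of i j "opn ` S" "cls ` T" N "{}"] by simp
qed

end

text \<open>The cumulative count at a pair is the exact count there plus exact counts at pairs of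
  smaller sum; induction on \<open>i + j\<close> cancels the latter against their mirror
  images.\<close>

lemma card_exact_symmetric:
  fixes p q :: "'a \<Rightarrow> nat"
  assumes "finite A"
    and sym: "\<And>i j. card {x \<in> A. p x \<le> i \<and> q x \<le> j} = card {x \<in> A. p x \<le> j \<and> q x \<le> i}"
  shows "card {x \<in> A. p x = i \<and> q x = j} = card {x \<in> A. p x = j \<and> q x = i}"
proof (induction "i + j" arbitrary: i j rule: less_induct)
  case less
  define e where "e = (\<lambda>(i, j). card {x \<in> A. p x = i \<and> q x = j})"
  have cum: "card {x \<in> A. p x \<le> i \<and> q x \<le> j} = e (i, j) + sum e ({..i} \<times> {..j} - {(i, j)})" for i j
  proof -
    have "{x \<in> A. p x \<le> i \<and> q x \<le> j} = (\<Union>z\<in>{..i} \<times> {..j}. {x \<in> A. p x = fst z \<and> q x = snd z})"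
      by auto
    also have "card \<dots> = (\<Sum>z\<in>{..i} \<times> {..j}. card {x \<in> A. p x = fst z \<and> q x = snd z})"
      using assms(1) by (intro card_UN_disjoint) auto
    also have "\<dots> = sum e ({..i} \<times> {..j})"
      by (intro sum.cong) (auto simp: e_def)
    also have "\<dots> = e (i, j) + sum e ({..i} \<times> {..j} - {(i, j)})"
      by (intro sum.remove) auto
    finally show ?thesis .
  qed
  have "sum e ({..j} \<times> {..i} - {(j, i)}) = sum e (prod.swap ` ({..i} \<times> {..j} - {(i, j)}))"
    by (intro arg_cong[of _ _ "sum e"]) auto
  also have "\<dots> = (\<Sum>z\<in>{..i} \<times> {..j} - {(i, j)}. e (prod.swap z))"
    by (subst sum.reindex) auto
  also have "\<dots> = sum e ({..i} \<times> {..j} - {(i, j)})"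
  proof (rule sum.cong[OF refl])
    fix z assume z: "z \<in> {..i} \<times> {..j} - {(i, j)}"
    obtain i' j' where ze: "z = (i', j')" by force
    have "i' + j' < i + j" using z ze by auto
    from less[OF this] show "e (prod.swap z) = e z" by (simp add: ze e_def)
  qed
  finally show ?case
    using sym[of i j] cum[of i j] cum[of j i] by (simp add: e_def)
qed

section \<open>Maximal pairwise related sets as bounds\<close>

lemma finite_pairwise_cards:
  "finite {k. \<exists>A. A \<subseteq> {1..n::nat} \<and> card A = k \<and> (\<forall>a\<in>A. \<forall>b\<in>A. a \<noteq> b \<longrightarrow> C a b \<or> C b a)}"
proof (rule finite_subset)
  show "{k. \<exists>A. A \<subseteq> {1..n::nat} \<and> card A = k \<and> (\<forall>a\<in>A. \<forall>b\<in>A. a \<noteq> b \<longrightarrow> C a b \<or> C b a)} \<subseteq> {..n}"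
    using card_mono[of "{1..n}"] by fastforce
qed simp

lemma Max_pairwise_le_iff:
  "Max {k. \<exists>A. A \<subseteq> {1..n::nat} \<and> card A = k \<and> (\<forall>a\<in>A. \<forall>b\<in>A. a \<noteq> b \<longrightarrow> C a b \<or> C b a)} \<le> k \<longleftrightarrow>
   (\<forall>A\<subseteq>{1..n}. (\<forall>a\<in>A. \<forall>b\<in>A. a \<noteq> b \<longrightarrow> C a b \<or> C b a) \<longrightarrow> card A \<le> k)"
proof -
  have "0 \<in> {k. \<exists>A. A \<subseteq> {1..n::nat} \<and> card A = k \<and> (\<forall>a\<in>A. \<forall>b\<in>A. a \<noteq> b \<longrightarrow> C a b \<or> C b a)}"
    by (auto intro!: exI[of _ "{}"])
  then have ne: "{k. \<exists>A. A \<subseteq> {1..n::nat} \<and> card A = k \<and> (\<forall>a\<in>A. \<forall>b\<in>A. a \<noteq> b \<longrightarrow> C a b \<or> C b a)} \<noteq> {}"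
    by blast
  show ?thesis unfolding Max_le_iff[OF finite_pairwise_cards ne] by auto
qed

section \<open>Permutations\<close>

definition up_set :: "nat \<Rightarrow> (nat \<Rightarrow> nat) \<Rightarrow> nat set" where
  "up_set n \<sigma> = {v \<in> {1..n}. v \<le> \<sigma> v}"

text \<open>For a permutation of the vertices this is the image of \<open>up_set\<close>; it is
  phrased with \<open>inv\<close> to match \<open>degseq\<close>.\<close>

definition up_image :: "nat \<Rightarrow> (nat \<Rightarrow> nat) \<Rightarrow> nat set" where
  "up_image n \<sigma> = {v \<in> {1..n}. inv \<sigma> v \<le> v}"

lemma degseq_eq_iff:
  "degseq n \<sigma> = degseq n \<tau> \<longleftrightarrow> up_set n \<sigma> = up_set n \<tau> \<and> up_image n \<sigma> = up_image n \<tau>"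
proof -
  have "degseq n \<sigma> = degseq n \<tau> \<longleftrightarrow>
      (\<forall>v\<in>{1..n}. (v \<le> \<sigma> v \<longleftrightarrow> v \<le> \<tau> v) \<and> (inv \<sigma> v \<le> v \<longleftrightarrow> inv \<tau> v \<le> v))"
    unfolding degseq_def map_eq_conv set_upt atLeastLessThanSuc_atLeastAtMost Suc_eq_plus1[symmetric]
    by (intro ball_cong) auto
  moreover have "{v \<in> B. P v} = {v \<in> B. Q v} \<longleftrightarrow> (\<forall>v\<in>B. P v \<longleftrightarrow> Q v)" for B :: "nat set" and P Q
    by auto
  ultimately show ?thesis unfolding up_set_def up_image_def by (simp only: ball_conj_distrib)
qed

text \<open>Doubling the time axis lets a vertex open its upper arc before closing one (so that loops and
  the weak inequality in upper crossings are allowed), but close a lower arc before opening one.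
  A lower arc is opened by its smaller endpoint \<open>\<sigma> a\<close>, hence is a value of \<open>inv \<sigma>\<close>.\<close>

locale upper_lower =
  fixes n :: nat and S T :: "nat set"
  assumes S_sub: "S \<subseteq> {1..n}" and T_sub: "T \<subseteq> {1..n}"
begin

sublocale up: arc_system S T "\<lambda>a. 2 * a" "\<lambda>b. 2 * b + 1"
proof
  show "finite S" "finite T" using S_sub T_sub finite_subset by blast+
  show "2 * a \<noteq> 2 * b + 1" for a b :: nat by presburger
qed (auto simp: strict_mono_def)

text \<open>For a permutation with upper openers \<open>S\<close> and upper closers
  \<open>T\<close>, a vertex outside \<open>T\<close> is the smaller endpoint of a lower arc and a
  vertex outside \<open>S\<close> the larger one. With odd opening and even closing times, opening
  before closing is a strict inequality of vertices.\<close>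

sublocale lo: arc_system "{1..n} - T" "{1..n} - S" "\<lambda>a. 2 * a + 1" "\<lambda>b. 2 * b"
proof
  show "2 * a + 1 \<noteq> 2 * b" for a b :: nat by presburger
qed (auto simp: strict_mono_def)

definition perms :: "(nat \<Rightarrow> nat) set" where
  "perms = {\<sigma>. \<sigma> permutes {1..n} \<and> up_set n \<sigma> = S \<and> up_image n \<sigma> = T}"

lemma perms_facts:
  assumes "\<sigma> \<in> perms"
  shows "\<sigma> permutes {1..n}" "\<And>v. v \<in> {1..n} \<Longrightarrow> v \<in> S \<longleftrightarrow> v \<le> \<sigma> v"
    "\<And>v. v \<in> {1..n} \<Longrightarrow> v \<in> T \<longleftrightarrow> inv \<sigma> v \<le> v"
    "bij_betw \<sigma> S T" "bij_betw (inv \<sigma>) ({1..n} - T) ({1..n} - S)"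
proof -
  show p: "\<sigma> permutes {1..n}" using assms by (simp add: perms_def)
  show S: "v \<in> S \<longleftrightarrow> v \<le> \<sigma> v" if "v \<in> {1..n}" for v
    using assms that by (auto simp: perms_def up_set_def)
  show T: "v \<in> T \<longleftrightarrow> inv \<sigma> v \<le> v" if "v \<in> {1..n}" for v
    using assms that by (auto simp: perms_def up_image_def)
  have mem: "\<sigma> v \<in> {1..n} \<longleftrightarrow> v \<in> {1..n}" "inv \<sigma> v \<in> {1..n} \<longleftrightarrow> v \<in> {1..n}" for v
    using permutes_in_image[OF p] permutes_in_image[OF permutes_inv[OF p]] by auto
  note inv = permutes_inverses[OF p]
  have ST: "\<sigma> v \<in> T \<longleftrightarrow> v \<in> S" if "v \<in> {1..n}" for v
    using S[OF that] T[of "\<sigma> v"] mem(1)[of v] that inv by simp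
  show "bij_betw \<sigma> S T"
  proof (rule bij_betw_byWitness[where f' = "inv \<sigma>"])
    show "\<sigma> ` S \<subseteq> T" using ST S_sub by auto
    show "inv \<sigma> ` T \<subseteq> S"
    proof
      fix a assume "a \<in> inv \<sigma> ` T"
      then obtain v where v: "v \<in> T" "a = inv \<sigma> v" by blast
      then have "a \<in> {1..n}" using T_sub mem(2) by blast
      then show "a \<in> S" using ST[of a] v inv by simp
    qed
  qed (simp_all add: inv)
  show "bij_betw (inv \<sigma>) ({1..n} - T) ({1..n} - S)"
  proof (rule bij_betw_byWitness[where f' = \<sigma>])
    show "\<sigma> ` ({1..n} - S) \<subseteq> {1..n} - T" using ST mem(1) by blast
    show "inv \<sigma> ` ({1..n} - T) \<subseteq> {1..n} - S"
    proof
      fix a assume "a \<in> inv \<sigma> ` ({1..n} - T)"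
      then obtain v where v: "v \<in> {1..n}" "v \<notin> T" "a = inv \<sigma> v" by blast
      then have "a \<in> {1..n}" using mem(2) by blast
      then show "a \<in> {1..n} - S" using ST[of a] v inv by simp
    qed
  qed (simp_all add: inv)
qed

text \<open>\<open>C\<close> stands for \<open>crosses\<close> or \<open>nests\<close>, and
  \<open>R\<close> for the corresponding order. Related arcs are of one kind, so a pairwise related
  set is all upper or all lower; within a kind, relatedness says that the arcs are open together and
  their closers follow \<open>R\<close>. Lower arcs are ordered by their smaller endpoint
  \<open>\<sigma> a\<close>.\<close>

lemma pairwise_iff_chains:
  assumes sig: "\<sigma> \<in> perms"
    and upper: "\<And>a b. a < b \<Longrightarrow> a \<le> \<sigma> a \<Longrightarrow> b \<le> \<sigma> b \<Longrightarrow> b \<le> \<sigma> a \<and> R (\<sigma> a) (\<sigma> b) \<longleftrightarrow> C a b \<or> C b a"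
    and lower: "\<And>a b. \<sigma> a < \<sigma> b \<Longrightarrow> \<sigma> a < a \<Longrightarrow> \<sigma> b < b \<Longrightarrow> \<sigma> b < a \<and> R a b \<longleftrightarrow> C a b \<or> C b a"
    and mixed: "\<And>a b. C a b \<Longrightarrow> a \<le> \<sigma> a \<longleftrightarrow> b \<le> \<sigma> b"
  shows "(\<forall>A\<subseteq>{1..n}. (\<forall>a\<in>A. \<forall>b\<in>A. a \<noteq> b \<longrightarrow> C a b \<or> C b a) \<longrightarrow> card A \<le> k) \<longleftrightarrow>
    up.chains_bounded R k (restrict \<sigma> S) \<and> lo.chains_bounded R k (restrict (inv \<sigma>) ({1..n} - T))"
    (is "?L \<longleftrightarrow> ?U \<and> ?D")
proof (intro iffI conjI)
  note pf = perms_facts[OF sig]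
  note inv = permutes_inverses[OF pf(1)]
  have inj: "inj \<sigma>" by (rule permutes_inj[OF pf(1)])
  have inj': "inj (inv \<sigma>)" by (rule permutes_inj[OF permutes_inv[OF pf(1)]])
  {
    assume L: ?L
    show ?U
      unfolding up.chains_bounded_def
    proof (intro allI impI, elim conjE)
      fix A assume A: "A \<subseteq> S" "is_chain R (restrict \<sigma> S) A"
        and all: "\<forall>a\<in>A. \<forall>b\<in>A. 2 * b < 2 * restrict \<sigma> S a + 1"
      have ch: "R (\<sigma> a) (\<sigma> b)" if "a \<in> A" "b \<in> A" "a < b" for a b
        using A that unfolding is_chain_def by (metis restrict_apply' subsetD)
      have le: "b \<le> \<sigma> a" if "a \<in> A" "b \<in> A" for a b
      proof -
        have "2 * b < 2 * restrict \<sigma> S a + 1" using all that by blast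
        moreover have "a \<in> S" using A that by blast
        ultimately show ?thesis by simp
      qed
      have "C a b \<or> C b a" if "a \<in> A" "b \<in> A" "a \<noteq> b" for a b
        using upper[of a b] upper[of b a] ch[of a b] ch[of b a] le that
        by (cases "a < b") auto
      moreover have "A \<subseteq> {1..n}" using A(1) S_sub by blast
      ultimately show "card A \<le> k" using L by blast
    qed
    show ?D
      unfolding lo.chains_bounded_def
    proof (intro allI impI, elim conjE)
      let ?h = "restrict (inv \<sigma>) ({1..n} - T)"
      fix B assume B: "B \<subseteq> {1..n} - T" "is_chain R ?h B"
        and all: "\<forall>a\<in>B. \<forall>b\<in>B. 2 * b + 1 < 2 * ?h a"
      have ch: "R (inv \<sigma> a) (inv \<sigma> b)" if "a \<in> B" "b \<in> B" "a < b" for a b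
        using B that unfolding is_chain_def by (metis restrict_apply' subsetD)
      have lt: "b < inv \<sigma> a" if "a \<in> B" "b \<in> B" for a b
      proof -
        have "2 * b + 1 < 2 * ?h a" using all that by blast
        moreover have "a \<in> {1..n} - T" using B that by blast
        ultimately show ?thesis by simp
      qed
      \<comment> \<open>A lower chain is a set \<open>B\<close> of smaller endpoints, whereas
        \<open>C\<close> refers to starting points; hence the passage to the image of
        \<open>B\<close> under \<open>inv \<sigma>\<close>.\<close>
      have "C a b \<or> C b a" if ab: "a \<in> inv \<sigma> ` B" "b \<in> inv \<sigma> ` B" "a \<noteq> b" for a b
      proof -
        obtain p q where pq: "p \<in> B" "q \<in> B" "a = inv \<sigma> p" "b = inv \<sigma> q" using ab by blast
        then have "p \<noteq> q" using ab by blast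
        then show ?thesis
          using lower[of a b] lower[of b a] ch[of p q] ch[of q p] lt pq inv
          by (cases "p < q") auto
      qed
      then have "\<forall>a\<in>inv \<sigma> ` B. \<forall>b\<in>inv \<sigma> ` B. a \<noteq> b \<longrightarrow> C a b \<or> C b a" by (intro ballI impI)
      moreover have "inv \<sigma> ` B \<subseteq> {1..n}"
        using B(1) bij_betwE[OF pf(5)] by blast
      ultimately have "card (inv \<sigma> ` B) \<le> k" by (intro L[THEN spec, THEN mp, THEN mp])
      then show "card B \<le> k"
        using card_image[OF inj_on_subset[OF inj' subset_UNIV], of B] by simp
    qed
  }
  assume UD: "?U \<and> ?D"
  show ?L
  proof (intro allI impI)
    fix A assume A: "A \<subseteq> {1..n}" and pw: "\<forall>a\<in>A. \<forall>b\<in>A. a \<noteq> b \<longrightarrow> C a b \<or> C b a"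
    have same: "a \<le> \<sigma> a \<longleftrightarrow> b \<le> \<sigma> b" if "a \<in> A" "b \<in> A" for a b
    proof (cases "a = b")
      case False
      then have "C a b \<or> C b a" using pw that by blast
      then show ?thesis using mixed[of a b] mixed[of b a] by blast
    qed simp
    show "card A \<le> k"
    proof (cases "\<exists>a\<in>A. a \<le> \<sigma> a")
      case True
      then have u: "a \<le> \<sigma> a" if "a \<in> A" for a using same that by blast
      then have AS: "A \<subseteq> S" using A pf(2) by blast
      have key: "b \<le> \<sigma> a \<and> R (\<sigma> a) (\<sigma> b)" if "a \<in> A" "b \<in> A" "a < b" for a b
      proof -
        have "a \<noteq> b" using that(3) by simp
        then have "C a b \<or> C b a" using pw that(1,2) by blast
        then show ?thesis using upper[OF that(3) u[OF that(1)] u[OF that(2)]] by blast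
      qed
      have "is_chain R (restrict \<sigma> S) A"
        using key AS by (auto simp: is_chain_def subset_iff)
      moreover have "2 * b < 2 * restrict \<sigma> S a + 1" if "a \<in> A" "b \<in> A" for a b
      proof -
        \<comment> \<open>\<open>key\<close> covers \<open>a < b\<close>; otherwise
          \<open>b \<le> a \<le> \<sigma> a\<close>.\<close>
        have "b \<le> \<sigma> a"
          using key[of a b] u[of a] that by (cases a b rule: linorder_cases) auto
        then show ?thesis using AS that by auto
      qed
      ultimately show ?thesis
        using UD AS unfolding up.chains_bounded_def by blast
    next
      case False
      then have u: "\<sigma> a < a" if "a \<in> A" for a using that by auto
      define B where "B = \<sigma> ` A"
      have AS: "A \<subseteq> {1..n} - S" using A pf(2) u by force
      have "v \<in> {1..n} - T" if vB: "v \<in> B" for v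
      proof -
        obtain a where a: "a \<in> A" "v = \<sigma> a" using vB by (auto simp: B_def)
        then have "v \<in> {1..n}" using A permutes_in_image[OF pf(1)] by blast
        then show ?thesis using pf(3)[of v] a u[of a] inv by auto
      qed
      then have BT: "B \<subseteq> {1..n} - T" by blast
      have key: "\<sigma> b < a \<and> R a b" if "a \<in> A" "b \<in> A" "\<sigma> a < \<sigma> b" for a b
      proof -
        have "a \<noteq> b" using that(3) by auto
        then have "C a b \<or> C b a" using pw that(1,2) by blast
        then show ?thesis using lower[OF that(3) u[OF that(1)] u[OF that(2)]] by blast
      qed
      let ?h = "restrict (inv \<sigma>) ({1..n} - T)"
      have hB: "?h (\<sigma> a) = a" if "a \<in> A" for a
      proof -
        have "\<sigma> a \<in> {1..n} - T" using BT that by (auto simp: B_def)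
        then show ?thesis by (simp only: restrict_apply' inv)
      qed
      have "is_chain R ?h B"
        unfolding is_chain_def
      proof (intro ballI impI)
        fix p q assume "p \<in> B" "q \<in> B" "p < q"
        then obtain a b where "a \<in> A" "b \<in> A" "p = \<sigma> a" "q = \<sigma> b" by (auto simp: B_def)
        then show "R (?h p) (?h q)" using key[of a b] hB \<open>p < q\<close> by (simp only: hB)
      qed
      moreover have "2 * q + 1 < 2 * ?h p" if pq: "p \<in> B" "q \<in> B" for p q
      proof -
        obtain a b where ab: "a \<in> A" "b \<in> A" "p = \<sigma> a" "q = \<sigma> b" using pq by (auto simp: B_def)
        \<comment> \<open>\<open>key\<close> covers \<open>\<sigma> a < \<sigma> b\<close>;
          otherwise \<open>\<sigma> b \<le> \<sigma> a < a\<close>.\<close>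
        then have "\<sigma> b < a"
          using key[of a b] u[of a] by (cases "\<sigma> a" "\<sigma> b" rule: linorder_cases) auto
        then show ?thesis using hB[OF ab(1)] ab by simp
      qed
      ultimately have "card B \<le> k"
        using UD BT unfolding lo.chains_bounded_def by blast
      then show ?thesis
        unfolding B_def using card_image[OF inj_on_subset[OF inj subset_UNIV], of A] by simp
    qed
  qed
qed

lemma Cr_le_iff:
  assumes "\<sigma> \<in> perms"
  shows "Cr n \<sigma> \<le> k \<longleftrightarrow>
    up.chains_bounded (<) k (restrict \<sigma> S) \<and> lo.chains_bounded (<) k (restrict (inv \<sigma>) ({1..n} - T))"
  unfolding Cr_def is_k_crossing_def Max_pairwise_le_iff
  by (rule pairwise_iff_chains[OF assms]) (auto simp: crosses_def)

lemma Ne_le_iff: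
  assumes "\<sigma> \<in> perms"
  shows "Ne n \<sigma> \<le> k \<longleftrightarrow>
    up.chains_bounded (>) k (restrict \<sigma> S) \<and> lo.chains_bounded (>) k (restrict (inv \<sigma>) ({1..n} - T))"
  unfolding Ne_def is_k_nesting_def Max_pairwise_le_iff
  by (rule pairwise_iff_chains[OF assms]) (auto simp: nests_def)

section \<open>Gluing upper and lower matchings\<close>

definition split_arcs :: "(nat \<Rightarrow> nat) \<Rightarrow> (nat \<Rightarrow> nat) \<times> (nat \<Rightarrow> nat)" where
  "split_arcs \<sigma> = (restrict \<sigma> S, restrict (inv \<sigma>) ({1..n} - T))"

lemma split_arcs_mem_iff:
  assumes "\<sigma> \<in> perms"
  shows "split_arcs \<sigma> \<in> up.matchings i j \<times> lo.matchings i j \<longleftrightarrow> Cr n \<sigma> \<le> i \<and> Ne n \<sigma> \<le> j"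
proof -
  note pf = perms_facts[OF assms]
  have "bij_betw (restrict \<sigma> S) S T" using pf(4) by (subst bij_betw_cong[of _ _ \<sigma>]) auto
  moreover have "bij_betw (restrict (inv \<sigma>) ({1..n} - T)) ({1..n} - T) ({1..n} - S)"
    using pf(5) by (subst bij_betw_cong[of _ _ "inv \<sigma>"]) auto
  moreover have "2 * a < 2 * restrict \<sigma> S a + 1" if "a \<in> S" for a
    using pf(2)[of a] that S_sub by auto
  moreover have "2 * a + 1 < 2 * restrict (inv \<sigma>) ({1..n} - T) a" if "a \<in> {1..n} - T" for a
    using pf(3)[of a] that by auto
  ultimately show ?thesis
    unfolding Cr_le_iff[OF assms] Ne_le_iff[OF assms] split_arcs_def up.matchings_def lo.matchings_def
    by auto
qed

lemma inj_on_split_arcs: "inj_on split_arcs perms"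
proof (rule inj_onI)
  fix \<sigma> \<tau> assume \<sigma>: "\<sigma> \<in> perms" and \<tau>: "\<tau> \<in> perms" and eq: "split_arcs \<sigma> = split_arcs \<tau>"
  note p\<sigma> = perms_facts[OF \<sigma>] and p\<tau> = perms_facts[OF \<tau>]
  have S: "\<sigma> v = \<tau> v" if "v \<in> S" for v
    using eq that unfolding split_arcs_def prod.inject by (metis restrict_apply')
  have T: "inv \<sigma> v = inv \<tau> v" if "v \<in> {1..n} - T" for v
    using eq that unfolding split_arcs_def prod.inject by (metis restrict_apply')
  show "\<sigma> = \<tau>"
  proof
    fix v
    consider "v \<in> S" | "v \<in> {1..n} - S" | "v \<notin> {1..n}" by blast
    then show "\<sigma> v = \<tau> v"
    proof cases
      case 2
      then have "v \<in> inv \<sigma> ` ({1..n} - T)" using bij_betw_imp_surj_on[OF p\<sigma>(5)] by simp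
      then obtain w where w: "w \<in> {1..n} - T" "v = inv \<sigma> w" by blast
      then have "v = inv \<tau> w" using T by simp
      then show ?thesis
        using w(2) permutes_inverses(1)[OF p\<sigma>(1)] permutes_inverses(1)[OF p\<tau>(1)] by metis
    next
      case 3
      then show ?thesis using permutes_not_in[OF p\<sigma>(1)] permutes_not_in[OF p\<tau>(1)] by simp
    qed (rule S)
  qed
qed

text \<open>The permutation follows \<open>g\<close> on \<open>S\<close> and the inverse of
  \<open>h\<close> on the other vertices. The weak inequality for \<open>g\<close> and the strict
  one for \<open>h\<close> force the upper arcs to be those of \<open>g\<close>, so the degree sets
  are \<open>S\<close> and \<open>T\<close> again.\<close>

lemma split_arcs_surj:
  assumes g: "bij_betw g S T" "g \<in> extensional S" "\<And>a. a \<in> S \<Longrightarrow> a \<le> g a"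
    and h: "bij_betw h ({1..n} - T) ({1..n} - S)" "h \<in> extensional ({1..n} - T)"
      "\<And>v. v \<in> {1..n} - T \<Longrightarrow> v < h v"
  shows "\<exists>\<sigma>\<in>perms. split_arcs \<sigma> = (g, h)"
proof -
  define k where "k = inv_into ({1..n} - T) h"
  define \<sigma> where "\<sigma> v = (if v \<in> S then g v else if v \<in> {1..n} then k v else v)" for v
  have k: "bij_betw k ({1..n} - S) ({1..n} - T)"
    unfolding k_def by (rule bij_betw_inv_into[OF h(1)])
  have "bij_betw \<sigma> S T" using g(1) by (subst bij_betw_cong[of _ _ g]) (auto simp: \<sigma>_def)
  moreover have "bij_betw \<sigma> ({1..n} - S) ({1..n} - T)"
    using k by (subst bij_betw_cong[of _ _ k]) (auto simp: \<sigma>_def)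
  ultimately have "bij_betw \<sigma> (S \<union> ({1..n} - S)) (T \<union> ({1..n} - T))"
    by (rule bij_betw_combine) auto
  moreover have "S \<union> ({1..n} - S) = {1..n}" "T \<union> ({1..n} - T) = {1..n}" using S_sub T_sub by auto
  ultimately have "bij_betw \<sigma> {1..n} {1..n}" by simp
  then have p: "\<sigma> permutes {1..n}"
    by (rule bij_imp_permutes) (use S_sub in \<open>auto simp: \<sigma>_def\<close>)
  have inv_eq: "inv \<sigma> w = v" if "\<sigma> v = w" for v w
    using that permutes_inverses(2)[OF p] by auto
  have invT: "inv \<sigma> w = h w \<and> w < h w" if w: "w \<in> {1..n} - T" for w
  proof -
    have hw: "h w \<in> {1..n} - S" using bij_betwE[OF h(1)] w by blast
    have "k (h w) = w" unfolding k_def by (rule bij_betw_inv_into_left[OF h(1) w])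
    then have "\<sigma> (h w) = w" using hw by (auto simp: \<sigma>_def)
    then show ?thesis using inv_eq h(3)[OF w] by blast
  qed
  have "v \<le> \<sigma> v \<longleftrightarrow> v \<in> S" if v: "v \<in> {1..n}" for v
  proof (cases "v \<in> S")
    case True
    then show ?thesis using g(3) by (simp add: \<sigma>_def)
  next
    case False
    then have kv: "\<sigma> v = k v" "k v \<in> {1..n} - T" using v bij_betwE[OF k] by (auto simp: \<sigma>_def)
    have "inv \<sigma> (k v) = v" using inv_eq kv(1) by blast
    then have "k v < v" using invT[OF kv(2)] by auto
    then show ?thesis using False kv(1) by simp
  qed
  then have "up_set n \<sigma> = S" using S_sub by (auto simp: up_set_def)
  moreover have "inv \<sigma> w \<le> w \<longleftrightarrow> w \<in> T" if w: "w \<in> {1..n}" for w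
  proof (cases "w \<in> T")
    case True
    then obtain v where v: "v \<in> S" "w = g v" using bij_betw_imp_surj_on[OF g(1)] by blast
    then have "inv \<sigma> w = v" by (intro inv_eq) (simp add: \<sigma>_def)
    then show ?thesis using True g(3)[OF v(1)] v(2) by simp
  next
    case False
    then show ?thesis using invT[of w] w by auto
  qed
  then have "up_image n \<sigma> = T" using T_sub by (auto simp: up_image_def)
  ultimately have "\<sigma> \<in> perms" using p by (simp add: perms_def)
  moreover have "restrict \<sigma> S = g"
    by (rule extensionalityI[OF restrict_extensional g(2)]) (simp add: \<sigma>_def)
  moreover have "restrict (inv \<sigma>) ({1..n} - T) = h"
    by (rule extensionalityI[OF restrict_extensional h(2)]) (use invT in simp)
  ultimately show ?thesis by (auto simp: split_arcs_def)
qed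

text \<open>Pairwise crossing or nesting arcs lie within one family, so the bounds hold for a
  permutation iff they hold for both of its matchings, and these can be chosen
  independently.\<close>

lemma card_perms_le:
  "card {\<sigma> \<in> perms. Cr n \<sigma> \<le> i \<and> Ne n \<sigma> \<le> j} = card (up.matchings i j) * card (lo.matchings i j)"
proof -
  have img: "split_arcs ` {\<sigma> \<in> perms. Cr n \<sigma> \<le> i \<and> Ne n \<sigma> \<le> j} = up.matchings i j \<times> lo.matchings i j"
  proof (intro equalityI subsetI)
    fix z assume "z \<in> split_arcs ` {\<sigma> \<in> perms. Cr n \<sigma> \<le> i \<and> Ne n \<sigma> \<le> j}"
    then show "z \<in> up.matchings i j \<times> lo.matchings i j" using split_arcs_mem_iff by blast
  next
    fix z assume z: "z \<in> up.matchings i j \<times> lo.matchings i j"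
    obtain g h where zz: "z = (g, h)" by force
    have gh: "\<forall>a\<in>S. 2 * a < 2 * g a + 1" "\<forall>v\<in>{1..n} - T. 2 * v + 1 < 2 * h v"
      "bij_betw g S T" "g \<in> extensional S"
      "bij_betw h ({1..n} - T) ({1..n} - S)" "h \<in> extensional ({1..n} - T)"
      using z unfolding zz up.matchings_def lo.matchings_def by blast+
    have "\<exists>\<sigma>\<in>perms. split_arcs \<sigma> = (g, h)"
    proof (rule split_arcs_surj)
      show "a \<le> g a" if "a \<in> S" for a
        using bspec[OF gh(1) that] by simp
      show "v < h v" if "v \<in> {1..n} - T" for v
        using bspec[OF gh(2) that] by simp
    qed (fact gh)+
    then obtain \<sigma> where \<sigma>: "\<sigma> \<in> perms" "split_arcs \<sigma> = z" unfolding zz by blast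
    then show "z \<in> split_arcs ` {\<sigma> \<in> perms. Cr n \<sigma> \<le> i \<and> Ne n \<sigma> \<le> j}"
      using split_arcs_mem_iff[OF \<sigma>(1), of i j] z by (intro image_eqI[of _ _ \<sigma>]) auto
  qed
  have "inj_on split_arcs {\<sigma> \<in> perms. Cr n \<sigma> \<le> i \<and> Ne n \<sigma> \<le> j}"
    by (rule inj_on_subset[OF inj_on_split_arcs]) auto
  from card_image[OF this] show ?thesis unfolding img card_cartesian_product by (rule sym)
qed

lemma card_perms_swap:
  "card {\<sigma> \<in> perms. Cr n \<sigma> = i \<and> Ne n \<sigma> = j} = card {\<sigma> \<in> perms. Cr n \<sigma> = j \<and> Ne n \<sigma> = i}"
proof (rule card_exact_symmetric)
  show "finite perms"
    by (rule finite_subset[OF _ finite_permutations[of "{1..n}"]]) (auto simp: perms_def)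
  show "card {\<sigma> \<in> perms. Cr n \<sigma> \<le> i \<and> Ne n \<sigma> \<le> j} = card {\<sigma> \<in> perms. Cr n \<sigma> \<le> j \<and> Ne n \<sigma> \<le> i}" for i j
    unfolding card_perms_le by (simp only: up.card_matchings_swap[of i j] lo.card_matchings_swap[of i j])
qed

end

theorem theorem1:
  fixes n :: nat and i j :: int and D :: "(int \<times> int) list"
  assumes "n \<ge> 1"
  shows "NC n i j D = NC n j i D"
proof (cases "\<exists>\<tau>. degseq n \<tau> = D \<and> 0 \<le> i \<and> 0 \<le> j")
  case True
  then obtain \<tau> where D: "D = degseq n \<tau>" and ij: "0 \<le> i" "0 \<le> j" by blast
  \<comment> \<open>\<open>\<tau>\<close> is an arbitrary function, used only to write
    \<open>D\<close> as a pair of vertex sets.\<close>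
  interpret upper_lower n "up_set n \<tau>" "up_image n \<tau>"
    by unfold_locales (auto simp: up_set_def up_image_def)
  have "NC n i j D = card {\<sigma> \<in> perms. Cr n \<sigma> = nat i \<and> Ne n \<sigma> = nat j}" if "0 \<le> i" "0 \<le> j" for i j
    unfolding NC_def perms_def D degseq_eq_iff using that
    by (intro arg_cong[of _ _ card]) auto
  then show ?thesis using ij card_perms_swap by simp
next
  case False
  \<comment> \<open>A negative number is no crossing or nesting number, and otherwise
    \<open>D\<close> is the degree sequence of no function.\<close>
  then have empty: "{\<sigma>. \<sigma> permutes {1..n} \<and> int (Cr n \<sigma>) = i \<and> int (Ne n \<sigma>) = j \<and> degseq n \<sigma> = D} = {}"
    "{\<sigma>. \<sigma> permutes {1..n} \<and> int (Cr n \<sigma>) = j \<and> int (Ne n \<sigma>) = i \<and> degseq n \<sigma> = D} = {}"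
    by auto
  then show ?thesis by (simp only: NC_def)
qed

end
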